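(* For a space $X$ the following statements are equivalent: (1) $X$ is uniformizable by a Bourbaki-complete uniformity; (2) $X$ is $\delta$-complete; (3) $X$ is homeomorphic to a closed subspace of $D^{\alpha}\times\mathbb R^{\alpha}$ for some cardinal $\alpha$, where $D$ is a discrete space whose cardinality is the cellularity of $X$; (4) $X$ is homeomorphic to a closed subspace of a product of locally compact metric spaces.
   Context: All spaces are Tychonoff. Uniform spaces are Hausdorff and given by covers: $\mu$ is a family of covers of $X$ (the uniform covers), containing every cover refined by a member of $\mu$, and such that any two members of $\mu$ have a common star-refinement in $\mu$. "Uniformizable by $\mu$" means that $\mu$ induces the topology of $X$. For a cover $\mathcal U$ of $X$ and $A\subset X$: $St(A,\mathcal U)=\bigcup\{U\in\mathcal U: U\cap A\neq\emptyset\}$, $St^0(A,\mathcal U)=A$, $St^m(A,\mathcal U)=St(St^{m-1}(A,\mathcal U),\mathcal U)$ for $m\geq 1$. A filter $\mathcal F$ on $X$ is Bourbaki-Cauchy if for every $\mathcal U\in\mu$ there are $m\in\mathbb N$, $U\in\mathcal U$ and $F\in\mathcal F$ with $F\subset St^m(U,\mathcal U)$. $(X,\mu)$ is Bourbaki-complete if every Bourbaki-Cauchy filter has a cluster point. The fine uniformity $\mathtt u$ of $X$ is the finest uniformity compatible with the topology of $X$. A cover is star-finite if each of its members meets at most finitely many of its members. $s_f\mathtt u$ is the uniformity on $X$ having as a base all star-finite open covers belonging to $\mathtt u$. $X$ is $\delta$-complete if $(X,s_f\mathtt u)$ is complete. The cellularity of $X$ is here the supremum of the cardinals of all partitions of $X$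 by open sets. *)

theory Defs
  imports "HOL-Analysis.Analysis"
begin

unbundle cardinal_syntax

definition tychonoff_space :: "'a topology \<Rightarrow> bool" where
  "tychonoff_space X \<longleftrightarrow> completely_regular_space X \<and> Hausdorff_space X"


subsection \<open>Uniformities given by covers\<close>

definition cover_refines :: "'a set set \<Rightarrow> 'a set set \<Rightarrow> bool" where
  "cover_refines \<U> \<V> \<longleftrightarrow> (\<forall>U\<in>\<U>. \<exists>V\<in>\<V>. U \<subseteq> V)"

definition star :: "'a set \<Rightarrow> 'a set set \<Rightarrow> 'a set" where
  "star A \<U> = \<Union>{U \<in> \<U>. U \<inter> A \<noteq> {}}"

primrec star_iter :: "nat \<Rightarrow> 'a set \<Rightarrow> 'a set set \<Rightarrow> 'a set" where
  "star_iter 0 A \<U> = A"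
| "star_iter (Suc m) A \<U> = star (star_iter m A \<U>) \<U>"

definition star_refines :: "'a set set \<Rightarrow> 'a set set \<Rightarrow> bool" where
  "star_refines \<U> \<V> \<longleftrightarrow> (\<forall>U\<in>\<U>. \<exists>V\<in>\<V>. star U \<U> \<subseteq> V)"

definition hausdorff_uniformity :: "'a set \<Rightarrow> 'a set set set \<Rightarrow> bool" where
  "hausdorff_uniformity A \<mu> \<longleftrightarrow>
     \<mu> \<noteq> {} \<and>
     (\<forall>\<U>\<in>\<mu>. \<Union>\<U> = A) \<and>
     (\<forall>\<U>\<in>\<mu>. \<forall>\<V>. \<Union>\<V> = A \<and> cover_refines \<U> \<V> \<longrightarrow> \<V> \<in> \<mu>) \<and>
     (\<forall>\<U>\<in>\<mu>. \<forall>\<V>\<in>\<mu>. \<exists>\<W>\<in>\<mu>. star_refines \<W> \<U> \<and> star_refines \<W> \<V>) \<and>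
     (\<forall>x\<in>A. \<forall>y\<in>A. x \<noteq> y \<longrightarrow> (\<exists>\<U>\<in>\<mu>. y \<notin> star {x} \<U>))"

definition uniform_topology :: "'a set \<Rightarrow> 'a set set set \<Rightarrow> 'a topology" where
  "uniform_topology A \<mu> =
     topology (\<lambda>S. S \<subseteq> A \<and> (\<forall>x\<in>S. \<exists>\<U>\<in>\<mu>. star {x} \<U> \<subseteq> S))"

definition uniformizable_by :: "'a topology \<Rightarrow> 'a set set set \<Rightarrow> bool" where
  "uniformizable_by X \<mu> \<longleftrightarrow>
     hausdorff_uniformity (topspace X) \<mu> \<and> uniform_topology (topspace X) \<mu> = X"

lemma openin_uniform_topology:
  assumes "hausdorff_uniformity A \<mu>"
  shows "openin (uniform_topology A \<mu>) S \<longleftrightarrow>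
           S \<subseteq> A \<and> (\<forall>x\<in>S. \<exists>\<U>\<in>\<mu>. star {x} \<U> \<subseteq> S)"
proof -
  have common: "\<exists>\<W>\<in>\<mu>. star {x} \<W> \<subseteq> star {x} \<U> \<inter> star {x} \<V>"
    if "\<U> \<in> \<mu>" "\<V> \<in> \<mu>" for \<U> \<V> x
  proof -
    obtain \<W> where \<W>: "\<W> \<in> \<mu>" "star_refines \<W> \<U>" "star_refines \<W> \<V>"
      using assms \<open>\<U> \<in> \<mu>\<close> \<open>\<V> \<in> \<mu>\<close> unfolding hausdorff_uniformity_def by meson
    have "star {x} \<W> \<subseteq> star {x} \<Y>" if r: "star_refines \<W> \<Y>" for \<Y>
    proof
      fix y assume "y \<in> star {x} \<W>"
      then obtain W where W: "W \<in> \<W>" "x \<in> W" "y \<in> W" by (auto simp: star_def)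
      then obtain Y where "Y \<in> \<Y>" "star W \<W> \<subseteq> Y" using r by (auto simp: star_refines_def)
      moreover have "W \<subseteq> star W \<W>" using W by (auto simp: star_def)
      ultimately show "y \<in> star {x} \<Y>" using W by (auto simp: star_def)
    qed
    with \<W> show ?thesis by blast
  qed
  have "istopology (\<lambda>S. S \<subseteq> A \<and> (\<forall>x\<in>S. \<exists>\<U>\<in>\<mu>. star {x} \<U> \<subseteq> S))"
    unfolding istopology_def
  proof (intro conjI allI impI)
    fix S T
    assume S: "S \<subseteq> A \<and> (\<forall>x\<in>S. \<exists>\<U>\<in>\<mu>. star {x} \<U> \<subseteq> S)"
      and T: "T \<subseteq> A \<and> (\<forall>x\<in>T. \<exists>\<U>\<in>\<mu>. star {x} \<U> \<subseteq> T)"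
    show "S \<inter> T \<subseteq> A" using S by blast
    show "\<forall>x\<in>S \<inter> T. \<exists>\<U>\<in>\<mu>. star {x} \<U> \<subseteq> S \<inter> T"
    proof
      fix x assume "x \<in> S \<inter> T"
      then obtain \<U> \<V> where "\<U> \<in> \<mu>" "star {x} \<U> \<subseteq> S" "\<V> \<in> \<mu>" "star {x} \<V> \<subseteq> T"
        using S T by blast
      with common[of \<U> \<V> x] show "\<exists>\<W>\<in>\<mu>. star {x} \<W> \<subseteq> S \<inter> T" by blast
    qed
  next
    fix \<K> assume K: "\<forall>K\<in>\<K>. K \<subseteq> A \<and> (\<forall>x\<in>K. \<exists>\<U>\<in>\<mu>. star {x} \<U> \<subseteq> K)"
    show "\<Union>\<K> \<subseteq> A" using K by blast
    show "\<forall>x\<in>\<Union>\<K>. \<exists>\<U>\<in>\<mu>. star {x} \<U> \<subseteq> \<Union>\<K>"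
      using K by (meson Union_iff Union_upper order_trans)
  qed
  then show ?thesis unfolding uniform_topology_def by simp
qed


subsection \<open>Filters and completeness\<close>

text \<open>A filter on \<open>A\<close> is a proper filter on the type that contains \<open>A\<close>.\<close>

definition filter_on :: "'a set \<Rightarrow> 'a filter \<Rightarrow> bool" where
  "filter_on A F \<longleftrightarrow> F \<noteq> bot \<and> F \<le> principal A"

definition cauchy_filter :: "'a set \<Rightarrow> 'a set set set \<Rightarrow> 'a filter \<Rightarrow> bool" where
  "cauchy_filter A \<mu> F \<longleftrightarrow>
     filter_on A F \<and> (\<forall>\<U>\<in>\<mu>. \<exists>U\<in>\<U>. eventually (\<lambda>x. x \<in> U) F)"

definition bourbaki_cauchy_filter :: "'a set \<Rightarrow> 'a set set set \<Rightarrow> 'a filter \<Rightarrow> bool" where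
  "bourbaki_cauchy_filter A \<mu> F \<longleftrightarrow>
     filter_on A F \<and>
     (\<forall>\<U>\<in>\<mu>. \<exists>m. \<exists>U\<in>\<U>. eventually (\<lambda>x. x \<in> star_iter m U \<U>) F)"

definition cluster_point_of :: "'a topology \<Rightarrow> 'a filter \<Rightarrow> 'a \<Rightarrow> bool" where
  "cluster_point_of X F x \<longleftrightarrow> (\<forall>S. eventually (\<lambda>y. y \<in> S) F \<longrightarrow> x \<in> X closure_of S)"

definition complete_uniformity :: "'a set \<Rightarrow> 'a set set set \<Rightarrow> bool" where
  "complete_uniformity A \<mu> \<longleftrightarrow>
     (\<forall>F. cauchy_filter A \<mu> F \<longrightarrow> (\<exists>x. limitin (uniform_topology A \<mu>) id x F))"

definition bourbaki_complete :: "'a set \<Rightarrow> 'a set set set \<Rightarrow> bool" where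
  "bourbaki_complete A \<mu> \<longleftrightarrow>
     (\<forall>F. bourbaki_cauchy_filter A \<mu> F \<longrightarrow> (\<exists>x. cluster_point_of (uniform_topology A \<mu>) F x))"


subsection \<open>\<open>\<delta>\<close>-completeness\<close>

text \<open>A uniformity is finer than another one iff it contains the other as a family of covers;
  \<open>GREATEST\<close> refers to this inclusion.\<close>

definition fine_uniformity :: "'a topology \<Rightarrow> 'a set set set" where
  "fine_uniformity X = (GREATEST \<mu>. uniformizable_by X \<mu>)"

definition star_finite :: "'a set set \<Rightarrow> bool" where
  "star_finite \<U> \<longleftrightarrow> (\<forall>U\<in>\<U>. finite {V \<in> \<U>. U \<inter> V \<noteq> {}})"

definition star_finite_fine_uniformity :: "'a topology \<Rightarrow> 'a set set set" where
  "star_finite_fine_uniformity X =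
     {\<V>. \<Union>\<V> = topspace X \<and>
          (\<exists>\<U>\<in>fine_uniformity X. star_finite \<U> \<and> (\<forall>U\<in>\<U>. openin X U) \<and> cover_refines \<U> \<V>)}"

definition delta_complete :: "'a topology \<Rightarrow> bool" where
  "delta_complete X \<longleftrightarrow> complete_uniformity (topspace X) (star_finite_fine_uniformity X)"


subsection \<open>Cellularity\<close>

definition open_partition :: "'a topology \<Rightarrow> 'a set set \<Rightarrow> bool" where
  "open_partition X \<P> \<longleftrightarrow> partition_on (topspace X) \<P> \<and> (\<forall>P\<in>\<P>. openin X P)"

definition cellularity_bound :: "'a topology \<Rightarrow> 'b rel \<Rightarrow> bool" where
  "cellularity_bound X \<kappa> \<longleftrightarrow> Card_order \<kappa> \<and> (\<forall>\<P>. open_partition X \<P> \<longrightarrow> |\<P>| \<le>o \<kappa>)"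

text \<open>The least upper bound is unique up to \<open>=o\<close>. It may be sought among the cardinals on
  the points of \<open>X\<close>, since the cardinality of the space is an upper bound; see
  \<open>cellularity_least\<close> below, where bounds on arbitrary types are admitted.\<close>

definition cellularity :: "'a topology \<Rightarrow> 'a rel" where
  "cellularity X =
     (SOME \<kappa>. cellularity_bound X \<kappa> \<and> (\<forall>\<kappa>'::'a rel. cellularity_bound X \<kappa>' \<longrightarrow> \<kappa> \<le>o \<kappa>'))"

lemma cellularity_bound_topspace: "cellularity_bound X |topspace X|"
  unfolding cellularity_bound_def
proof (intro conjI allI impI)
  show "Card_order |topspace X|" by (rule card_of_Card_order)
  fix \<P> assume "open_partition X \<P>"
  then have P: "\<Union>\<P> = topspace X" "disjoint \<P>" "{} \<notin> \<P>"
    by (auto simp: open_partition_def partition_on_def)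
  define f where "f P = (SOME x. x \<in> P)" for P :: "'a set"
  have f: "f P \<in> P" if "P \<in> \<P>" for P
    using that P(3) unfolding f_def by (metis ex_in_conv someI_ex)
  have "inj_on f \<P>"
    using f P(2) by (metis disjoint_def disjoint_iff inj_onI)
  moreover have "f ` \<P> \<subseteq> topspace X" using f P(1) by blast
  ultimately show "|\<P>| \<le>o |topspace X|" using card_of_ordLeq by blast
qed

lemma cellularity_exists:
  "\<exists>\<kappa>::'a rel. cellularity_bound X \<kappa> \<and> (\<forall>\<kappa>'::'a rel. cellularity_bound X \<kappa>' \<longrightarrow> \<kappa> \<le>o \<kappa>')"
  for X :: "'a topology"
proof -
  let ?R = "{\<kappa>::'a rel. cellularity_bound X \<kappa>}"
  have "?R \<noteq> {}" using cellularity_bound_topspace by blast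
  moreover have "\<forall>\<kappa>\<in>?R. Card_order \<kappa>" by (simp add: cellularity_bound_def)
  ultimately show ?thesis using exists_minim_Card_order[of ?R] by blast
qed

lemma cellularity_bound_cellularity: "cellularity_bound X (cellularity X)"
  using someI_ex[OF cellularity_exists[of X]] unfolding cellularity_def by blast

lemma cellularity_least:
  fixes X :: "'a topology" and \<kappa> :: "'b rel"
  assumes "cellularity_bound X \<kappa>"
  shows "cellularity X \<le>o \<kappa>"
proof (rule ccontr)
  have c: "Card_order (cellularity X)"
    using cellularity_bound_cellularity by (auto simp: cellularity_bound_def)
  have k: "Card_order \<kappa>" using assms by (auto simp: cellularity_bound_def)
  assume n: "\<not> cellularity X \<le>o \<kappa>"
  then have "\<kappa> <o cellularity X" using c k by (meson not_ordLeq_iff_ordLess card_order_on_def)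
  then have "|Field \<kappa>| \<le>o |Field (cellularity X)|"
    using ordLess_imp_ordLeq card_of_mono2 by blast
  then obtain g where g: "inj_on g (Field \<kappa>)"
    "g ` Field \<kappa> \<subseteq> Field (cellularity X)"
    by (metis card_of_ordLeq)
  define E where "E = g ` Field \<kappa>"
  have "bij_betw g (Field \<kappa>) E" using g by (simp add: E_def bij_betw_def)
  then have E: "\<kappa> =o |E|"
    using k by (meson card_of_Field_ordIso card_of_ordIsoI ordIso_symmetric ordIso_transitive)
  then have "cellularity_bound X |E|"
    using assms unfolding cellularity_bound_def
    by (meson card_of_Card_order ordLeq_ordIso_trans)
  then have "cellularity X \<le>o |E|"
    using someI_ex[OF cellularity_exists[of X]] unfolding cellularity_def by blast
  with E n show False using ordIso_symmetric ordLeq_ordIso_trans by blast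
qed


subsection \<open>Closed embeddings into products\<close>

definition closed_subspace_of :: "'a topology \<Rightarrow> 'b topology \<Rightarrow> bool" where
  "closed_subspace_of X Y \<longleftrightarrow> (\<exists>S. closedin Y S \<and> X homeomorphic_space subtopology Y S)"

text \<open>HOL cannot quantify over types inside a formula. The type arguments of the following two
  predicates tell in which types the discrete space, the index set (whose cardinality is
  \<open>\<alpha>\<close>) and the metric spaces are sought.\<close>

definition closed_in_discrete_real_power ::
    "'d itself \<Rightarrow> 'i itself \<Rightarrow> 'a topology \<Rightarrow> bool" where
  "closed_in_discrete_real_power _ _ X \<longleftrightarrow>
     (\<exists>(D::'d set) (I::'i set). |D| =o cellularity X \<and>
        closed_subspace_of X
          (prod_topology (product_topology (\<lambda>_. discrete_topology D) I)
                         (product_topology (\<lambda>_. euclideanreal) I)))"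

definition closed_in_locally_compact_metric_product ::
    "'i itself \<Rightarrow> 'm itself \<Rightarrow> 'a topology \<Rightarrow> bool" where
  "closed_in_locally_compact_metric_product _ _ X \<longleftrightarrow>
     (\<exists>(I::'i set) (M::'i \<Rightarrow> 'm metric).
        (\<forall>i\<in>I. locally_compact_space (mtopology_of (M i))) \<and>
        closed_subspace_of X (product_topology (\<lambda>i. mtopology_of (M i)) I))"

end

theory Submission
  imports Defs
begin

text \<open>
  The four conditions are tied together by an internal one, \<open>function_complete\<close>: a filter
  converges as soon as it contains a member of every partition of \<open>X\<close> into open sets and every
  continuous real function converges along it.

  The fine uniformity is described by normal covers, and the Urysohn construction gives each normal
  cover a subordinate family of continuous functions \<open>f\<^sub>U\<close>, each vanishing off \<open>U\<close>, such that every
  point has some \<open>f\<^sub>U\<close> equal to \<open>1\<close> there. The steps from covers to filters rest on the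
  intersection graph of a cover, in which two members are adjacent when they meet.

  If \<open>X\<close> carries a Bourbaki-complete uniformity, group the members of an open uniform cover by
  their component in this graph and their distance from a chosen root of the component. The unions
  of the groups form a star-finite open uniform cover, and each of them lies in an iterated star
  of the root. So Cauchy filters for \<open>s\<^sub>f\<close> of the fine uniformity are Bourbaki-Cauchy and have a
  cluster point, which is a limit because two-element covers separate points from closed sets.

  If \<open>X\<close> is \<open>\<delta>\<close>-complete, consider a filter that is controlled by the open partitions and the
  real functions. For a star-finite normal open cover it contains a component of the intersection graph,
  and components are countable. Number the members of that component by \<open>\<nu>\<close>; the function
  \<open>\<Sum> \<nu>(U) f\<^sub>U\<close> converges along the filter, so finitely many members of the cover suffice; as
  the \<open>f\<^sub>U\<close> converge too, one member is enough. The filter is Cauchy, and \<open>function_complete\<close>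
  follows.

  A continuous injection into a Hausdorff space is a closed embedding iff every filter whose image
  converges is itself convergent. For a Tychonoff space that is \<open>function_complete\<close>,
  all continuous maps into a discrete space of the cardinality of the cellularity, together with
  all continuous real functions, therefore give a closed embedding into a product. Read backwards, closed subspaces of \<open>D\<^sup>\<alpha> \<times> \<real>\<^sup>\<alpha>\<close> are
  \<open>function_complete\<close>.

  Finally, a locally compact metric space has a compatible metric in which every compact set has a
  relatively compact \<open>\<epsilon>\<close>-neighbourhood for a fixed \<open>\<epsilon>\<close>: with \<open>r(x)\<close> the radius up to which the
  closed balls around \<open>x\<close> are compact, take \<open>ln (1 + d(x,y) / min (r(x)) (r(y)))\<close>. Iterated stars of small
  balls are then relatively compact, so every ultrafilter finer than a Bourbaki-Cauchy filter
  converges in each coordinate of a product of such spaces, and closed subspaces of the product are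
  Bourbaki-complete.
\<close>

section \<open>Stars\<close>

lemma star_mono: "A \<subseteq> B \<Longrightarrow> star A \<U> \<subseteq> star B \<U>"
  by (auto simp: star_def)

lemma star_mono_refines: "cover_refines \<U> \<V> \<Longrightarrow> star A \<U> \<subseteq> star A \<V>"
  unfolding star_def cover_refines_def by blast

lemma member_subset_star: "U \<in> \<U> \<Longrightarrow> U \<inter> A \<noteq> {} \<Longrightarrow> U \<subseteq> star A \<U>"
  by (auto simp: star_def)

lemma subset_star: "A \<subseteq> \<Union>\<U> \<Longrightarrow> A \<subseteq> star A \<U>"
  by (auto simp: star_def)

lemma star_refines_imp_cover_refines: "star_refines \<U> \<V> \<Longrightarrow> cover_refines \<U> \<V>"
  unfolding star_refines_def cover_refines_def
  by (meson Union_upper subset_star subset_trans)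

lemma star_star_subset:
  assumes "star_refines \<W> \<U>"
  shows "star (star A \<W>) \<W> \<subseteq> star A \<U>"
proof
  fix y assume "y \<in> star (star A \<W>) \<W>"
  then obtain W W' where W: "W \<in> \<W>" "y \<in> W" "W' \<in> \<W>" "W' \<inter> A \<noteq> {}" "W \<inter> W' \<noteq> {}"
    by (auto simp: star_def)
  obtain U where "U \<in> \<U>" "star W' \<W> \<subseteq> U"
    using assms W by (auto simp: star_refines_def)
  moreover have "W \<subseteq> star W' \<W>" "W' \<subseteq> star W' \<W>"
    using W by (auto simp: star_def)
  ultimately have "U \<inter> A \<noteq> {}" "y \<in> U" using W by blast+
  then show "y \<in> star A \<U>" using \<open>U \<in> \<U>\<close> unfolding star_def by blast
qed

lemma openin_star: "\<forall>U\<in>\<U>. openin X U \<Longrightarrow> openin X (star A \<U>)"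
  unfolding star_def by blast

section \<open>Compatible uniformities\<close>

lemma hausdorff_uniformityD:
  assumes "hausdorff_uniformity A \<mu>"
  shows "\<And>\<U>. \<U> \<in> \<mu> \<Longrightarrow> \<Union>\<U> = A"
    and "\<And>\<U> \<V>. \<U> \<in> \<mu> \<Longrightarrow> \<Union>\<V> = A \<Longrightarrow> cover_refines \<U> \<V> \<Longrightarrow> \<V> \<in> \<mu>"
    and "\<And>\<U> \<V>. \<U> \<in> \<mu> \<Longrightarrow> \<V> \<in> \<mu> \<Longrightarrow> \<exists>\<W>\<in>\<mu>. star_refines \<W> \<U> \<and> star_refines \<W> \<V>"
proof -
  have *: "\<forall>\<U>\<in>\<mu>. \<Union>\<U> = A" "\<forall>\<U>\<in>\<mu>. \<forall>\<V>. \<Union>\<V> = A \<and> cover_refines \<U> \<V> \<longrightarrow> \<V> \<in> \<mu>"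
    "\<forall>\<U>\<in>\<mu>. \<forall>\<V>\<in>\<mu>. \<exists>\<W>\<in>\<mu>. star_refines \<W> \<U> \<and> star_refines \<W> \<V>"
    using assms unfolding hausdorff_uniformity_def by - (elim conjE, assumption)+
  show "\<And>\<U>. \<U> \<in> \<mu> \<Longrightarrow> \<Union>\<U> = A" using *(1) by (rule bspec)
  show "\<And>\<U> \<V>. \<U> \<in> \<mu> \<Longrightarrow> \<Union>\<V> = A \<Longrightarrow> cover_refines \<U> \<V> \<Longrightarrow> \<V> \<in> \<mu>" using *(2) by blast
  show "\<And>\<U> \<V>. \<U> \<in> \<mu> \<Longrightarrow> \<V> \<in> \<mu> \<Longrightarrow> \<exists>\<W>\<in>\<mu>. star_refines \<W> \<U> \<and> star_refines \<W> \<V>"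
    using *(3) by blast
qed

text \<open>The uniform interior of a set \<open>W\<close>, i.e. the set of points having a uniform star inside \<open>W\<close>, is open.\<close>

lemma uniform_interior_open:
  assumes "hausdorff_uniformity A \<mu>"
  shows "openin (uniform_topology A \<mu>) {x \<in> A. \<exists>\<U>\<in>\<mu>. star {x} \<U> \<subseteq> W}"
  unfolding openin_uniform_topology[OF assms]
proof (intro conjI ballI)
  fix x assume "x \<in> {x \<in> A. \<exists>\<U>\<in>\<mu>. star {x} \<U> \<subseteq> W}"
  then obtain \<U> where x: "x \<in> A" "\<U> \<in> \<mu>" "star {x} \<U> \<subseteq> W" by auto
  obtain \<V> where V: "\<V> \<in> \<mu>" "star_refines \<V> \<U>"
    using hausdorff_uniformityD(3)[OF assms x(2) x(2)] by blast
  have "star {y} \<V> \<subseteq> W" if "y \<in> star {x} \<V>" for y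
    using star_mono[of "{y}" "star {x} \<V>" \<V>] star_star_subset[OF V(2), of "{x}"] that x(3)
    by blast
  moreover have "star {x} \<V> \<subseteq> A"
    using hausdorff_uniformityD(1)[OF assms V(1)] by (auto simp: star_def)
  ultimately show "\<exists>\<U>\<in>\<mu>. star {x} \<U> \<subseteq> {x \<in> A. \<exists>\<U>\<in>\<mu>. star {x} \<U> \<subseteq> W}"
    using V(1) by blast
qed auto

lemma uniform_open_star_refinement:
  assumes \<mu>: "uniformizable_by X \<mu>" and "\<V> \<in> \<mu>"
  obtains \<W> where "\<W> \<in> \<mu>" "star_refines \<W> \<V>" "\<forall>W\<in>\<W>. openin X W"
proof -
  have H: "hausdorff_uniformity (topspace X) \<mu>" and T: "uniform_topology (topspace X) \<mu> = X"
    using \<mu> by (auto simp: uniformizable_by_def)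
  obtain \<W>1 where 1: "\<W>1 \<in> \<mu>" "star_refines \<W>1 \<V>"
    using hausdorff_uniformityD(3)[OF H assms(2) assms(2)] by blast
  obtain \<W>2 where 2: "\<W>2 \<in> \<mu>" "star_refines \<W>2 \<W>1"
    using hausdorff_uniformityD(3)[OF H 1(1) 1(1)] by blast
  define J where "J W = {x \<in> topspace X. \<exists>\<U>\<in>\<mu>. star {x} \<U> \<subseteq> W}" for W
  have Jsub: "J W \<subseteq> W" for W
  proof
    fix x assume "x \<in> J W"
    then obtain \<U> where U: "x \<in> topspace X" "\<U> \<in> \<mu>" "star {x} \<U> \<subseteq> W" by (auto simp: J_def)
    then show "x \<in> W" using subset_star[of "{x}" \<U>] hausdorff_uniformityD(1)[OF H U(2)] by blast
  qed
  have ref: "cover_refines \<W>2 (J ` \<W>1)"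
    unfolding cover_refines_def
  proof
    fix U assume U: "U \<in> \<W>2"
    then obtain W where W: "W \<in> \<W>1" "star U \<W>2 \<subseteq> W" using 2 by (auto simp: star_refines_def)
    have "x \<in> J W" if "x \<in> U" for x
      unfolding J_def using star_mono[of "{x}" U \<W>2] that W(2) 2(1) U hausdorff_uniformityD(1)[OF H 2(1)]
      by blast
    then show "\<exists>V\<in>J ` \<W>1. U \<subseteq> V" using W(1) by blast
  qed
  have "topspace X \<subseteq> \<Union>(J ` \<W>1)"
  proof
    fix x assume "x \<in> topspace X"
    then obtain U where "U \<in> \<W>2" "x \<in> U" using hausdorff_uniformityD(1)[OF H 2(1)] by auto
    moreover then obtain V where "V \<in> J ` \<W>1" "U \<subseteq> V" using ref unfolding cover_refines_def by metis
    ultimately show "x \<in> \<Union>(J ` \<W>1)" by (meson UnionI subsetD)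
  qed
  then have "\<Union>(J ` \<W>1) = topspace X"
    by (auto simp: J_def)
  then have "J ` \<W>1 \<in> \<mu>" using hausdorff_uniformityD(2)[OF H 2(1)] ref by blast
  moreover have "star_refines (J ` \<W>1) \<V>"
    unfolding star_refines_def
  proof
    fix U assume "U \<in> J ` \<W>1"
    then obtain W where W: "W \<in> \<W>1" "U = J W" by blast
    have "star U (J ` \<W>1) \<subseteq> star W \<W>1"
      using Jsub W unfolding star_def by blast
    then show "\<exists>V\<in>\<V>. star U (J ` \<W>1) \<subseteq> V"
      using 1(2) W(1) unfolding star_refines_def by (meson subset_trans)
  qed
  moreover have "\<forall>W\<in>J ` \<W>1. openin X W"
    using uniform_interior_open[OF H] unfolding J_def T by auto
  ultimately show ?thesis using that by blast
qed

section \<open>The fine uniformity\<close>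

text \<open>A normal family is a family of covers in which every cover has an open star-refinement within the
  family. The union of all normal families is again one; it plays the role of the covers that begin an
  infinite sequence of successive open star-refinements, and no sequence has to be chosen.\<close>

definition normal_family :: "'a topology \<Rightarrow> 'a set set set \<Rightarrow> bool" where
  "normal_family X \<S> \<longleftrightarrow>
     (\<forall>\<U>\<in>\<S>. \<Union>\<U> = topspace X \<and> (\<exists>\<W>\<in>\<S>. star_refines \<W> \<U> \<and> (\<forall>W\<in>\<W>. openin X W)))"

text \<open>The normal covers form the largest normal family; for a Tychonoff space they are the fine uniformity.\<close>

definition normal_covers :: "'a topology \<Rightarrow> 'a set set set" where
  "normal_covers X = \<Union>{\<S>. normal_family X \<S>}"

lemma normal_family_normal_covers: "normal_family X (normal_covers X)"
  unfolding normal_family_def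
proof (intro ballI conjI)
  fix \<U> assume "\<U> \<in> normal_covers X"
  then obtain \<S> where S: "normal_family X \<S>" "\<U> \<in> \<S>" by (auto simp: normal_covers_def)
  then have *: "\<Union>\<U> = topspace X \<and> (\<exists>\<W>\<in>\<S>. star_refines \<W> \<U> \<and> (\<forall>W\<in>\<W>. openin X W))"
    unfolding normal_family_def by (elim bspec)
  moreover have "\<S> \<subseteq> normal_covers X" using S(1) by (auto simp: normal_covers_def)
  ultimately show "\<Union>\<U> = topspace X"
    "\<exists>\<W>\<in>normal_covers X. star_refines \<W> \<U> \<and> (\<forall>W\<in>\<W>. openin X W)" by (simp, meson subsetD)
qed

lemma normal_coversD:
  assumes "\<U> \<in> normal_covers X"
  shows "\<Union>\<U> = topspace X"
    and "\<exists>\<W>\<in>normal_covers X. star_refines \<W> \<U> \<and> (\<forall>W\<in>\<W>. openin X W)"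
  using bspec[OF normal_family_normal_covers[of X, unfolded normal_family_def] assms] by simp_all

lemma normal_coversI: "normal_family X \<S> \<Longrightarrow> \<U> \<in> \<S> \<Longrightarrow> \<U> \<in> normal_covers X"
  by (auto simp: normal_covers_def)

lemma normal_covers_coarser:
  assumes "\<U> \<in> normal_covers X" "cover_refines \<U> \<V>" "\<Union>\<V> = topspace X"
  shows "\<V> \<in> normal_covers X"
proof (rule normal_coversI)
  have "star_refines \<W> \<V>" if "star_refines \<W> \<U>" for \<W>
    using that assms(2) unfolding star_refines_def cover_refines_def by (meson subset_trans)
  then have "\<exists>\<W>\<in>normal_covers X. star_refines \<W> \<V> \<and> (\<forall>W\<in>\<W>. openin X W)"
    using normal_coversD(2)[OF assms(1)] by meson
  then show "normal_family X (insert \<V> (normal_covers X))"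
    using normal_coversD[of _ X] assms(3) unfolding normal_family_def
    by (intro ballI) (erule insertE, simp_all)
qed simp

text \<open>The coarsest common refinement by pairwise intersections.\<close>

definition meet :: "'a set set \<Rightarrow> 'a set set \<Rightarrow> 'a set set" where
  "meet \<U> \<V> = {U \<inter> V | U V. U \<in> \<U> \<and> V \<in> \<V>}"

lemma Union_meet: "\<Union>(meet \<U> \<V>) = \<Union>\<U> \<inter> \<Union>\<V>"
  unfolding meet_def by blast

lemma cover_refines_meet: "cover_refines (meet \<U> \<V>) \<U>" "cover_refines (meet \<U> \<V>) \<V>"
  by (auto simp: meet_def cover_refines_def)

lemma star_meet_subset:
  "star (U \<inter> V) (meet \<U> \<V>) \<subseteq> star U \<U> \<inter> star V \<V>"
proof
  fix y assume "y \<in> star (U \<inter> V) (meet \<U> \<V>)"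
  then obtain A B where "A \<in> \<U>" "B \<in> \<V>" "y \<in> A" "y \<in> B" "A \<inter> U \<noteq> {}" "B \<inter> V \<noteq> {}"
    by (auto simp: star_def meet_def)
  then show "y \<in> star U \<U> \<inter> star V \<V>" by (auto simp: star_def)
qed

lemma star_refines_meet:
  assumes "star_refines \<W> \<U>" "star_refines \<W>' \<V>"
  shows "star_refines (meet \<W> \<W>') (meet \<U> \<V>)"
  unfolding star_refines_def
proof
  fix W assume "W \<in> meet \<W> \<W>'"
  then obtain W1 W2 where W: "W = W1 \<inter> W2" "W1 \<in> \<W>" "W2 \<in> \<W>'" by (auto simp: meet_def)
  then obtain U V where UV: "U \<in> \<U>" "V \<in> \<V>" "star W1 \<W> \<subseteq> U" "star W2 \<W>' \<subseteq> V"
    using assms by (meson star_refines_def)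
  then have "star W (meet \<W> \<W>') \<subseteq> U \<inter> V"
    using star_meet_subset[of W1 W2 \<W> \<W>'] W(1) by blast
  moreover have "U \<inter> V \<in> meet \<U> \<V>" using UV by (auto simp: meet_def)
  ultimately show "\<exists>V\<in>meet \<U> \<V>. star W (meet \<W> \<W>') \<subseteq> V" by blast
qed

lemma normal_covers_meet:
  assumes "\<U> \<in> normal_covers X" "\<V> \<in> normal_covers X"
  shows "meet \<U> \<V> \<in> normal_covers X"
proof (rule normal_coversI)
  show "normal_family X {meet \<A> \<B> | \<A> \<B>. \<A> \<in> normal_covers X \<and> \<B> \<in> normal_covers X}"
    (is "normal_family X ?S")
    unfolding normal_family_def
  proof (intro ballI conjI)
    fix \<C> assume "\<C> \<in> ?S"
    then obtain \<A> \<B> where AB: "\<C> = meet \<A> \<B>" "\<A> \<in> normal_covers X" "\<B> \<in> normal_covers X" by blast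
    show "\<Union>\<C> = topspace X"
      using normal_coversD(1)[OF AB(2)] normal_coversD(1)[OF AB(3)] AB(1) by (simp add: Union_meet)
    obtain \<W> \<W>' where W: "\<W> \<in> normal_covers X" "\<W>' \<in> normal_covers X"
        "star_refines \<W> \<A>" "star_refines \<W>' \<B>" "\<forall>W\<in>\<W>. openin X W" "\<forall>W\<in>\<W>'. openin X W"
      using AB normal_coversD(2) by metis
    have "\<forall>W\<in>meet \<W> \<W>'. openin X W"
      using W by (auto simp: meet_def)
    moreover have "meet \<W> \<W>' \<in> ?S" using W by blast
    ultimately show "\<exists>\<W>\<in>?S. star_refines \<W> \<C> \<and> (\<forall>W\<in>\<W>. openin X W)"
      using star_refines_meet[OF W(3,4)] AB(1) by blast
  qed
qed (use assms in blast)

text \<open>A cover with a Lebesgue number for the pseudometric \<open>\<bar>g y - g x\<bar>\<close> is normal.\<close>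

lemma normal_covers_of_function:
  assumes g: "continuous_map X euclideanreal g" and e: "\<epsilon> > 0" and un: "\<Union>\<V> = topspace X"
    and ref: "\<And>x. x \<in> topspace X \<Longrightarrow> \<exists>V\<in>\<V>. {y \<in> topspace X. \<bar>g y - g x\<bar> < \<epsilon>} \<subseteq> V"
  shows "\<V> \<in> normal_covers X"
proof (rule normal_coversI)
  define \<S> where "\<S> = {\<V>. \<Union>\<V> = topspace X \<and>
      (\<exists>\<epsilon>>0. \<forall>x\<in>topspace X. \<exists>V\<in>\<V>. {y \<in> topspace X. \<bar>g y - g x\<bar> < \<epsilon>} \<subseteq> V)}"
  show "\<V> \<in> \<S>" using e un ref by (auto simp: \<S>_def)
  show "normal_family X \<S>"
    unfolding normal_family_def
  proof (intro ballI conjI)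
    fix \<V> assume "\<V> \<in> \<S>"
    then obtain \<epsilon> where V: "\<Union>\<V> = topspace X" and e: "\<epsilon> > 0"
      and r: "\<And>x. x \<in> topspace X \<Longrightarrow> \<exists>V\<in>\<V>. {y \<in> topspace X. \<bar>g y - g x\<bar> < \<epsilon>} \<subseteq> V"
      by (auto simp: \<S>_def)
    show "\<Union>\<V> = topspace X" by fact
    define B where "B x = {y \<in> topspace X. \<bar>g y - g x\<bar> < \<epsilon>/3}" for x
    have op: "openin X (B x)" for x
    proof -
      have "B x = {y \<in> topspace X. g y \<in> {g x - \<epsilon>/3 <..< g x + \<epsilon>/3}}"
        by (auto simp: B_def abs_if split: if_splits)
      then show ?thesis
        using openin_continuous_map_preimage[OF g, of "{g x - \<epsilon>/3 <..< g x + \<epsilon>/3}"] by simp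
    qed
    have "B ` topspace X \<in> \<S>"
    proof -
      have "\<Union>(B ` topspace X) = topspace X" using e by (auto simp: B_def)
      then show ?thesis unfolding \<S>_def using e
        by (auto intro!: exI[of _ "\<epsilon>/3"] simp: B_def)
    qed
    moreover have "star_refines (B ` topspace X) \<V>"
      unfolding star_refines_def
    proof
      fix W assume "W \<in> B ` topspace X"
      then obtain x where x: "x \<in> topspace X" "W = B x" by blast
      have "star W (B ` topspace X) \<subseteq> {y \<in> topspace X. \<bar>g y - g x\<bar> < \<epsilon>}"
      proof
        fix y assume "y \<in> star W (B ` topspace X)"
        then obtain z w where "y \<in> B z" "w \<in> B z" "w \<in> B x" by (auto simp: star_def x)
        then show "y \<in> {y \<in> topspace X. \<bar>g y - g x\<bar> < \<epsilon>}"
          using abs_triangle_ineq4[of "g y - g z" "g w - g z"] abs_triangle_ineq[of "g y - g w" "g w - g x"]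
          by (simp add: B_def)
      qed
      then show "\<exists>V\<in>\<V>. star W (B ` topspace X) \<subseteq> V"
        using r[OF x(1)] by (meson subset_trans)
    qed
    ultimately show "\<exists>\<W>\<in>\<S>. star_refines \<W> \<V> \<and> (\<forall>W\<in>\<W>. openin X W)"
      using op by blast
  qed
qed

text \<open>The two-element open cover by the overlapping sets \<open>g < 2/3\<close> and \<open>g > 1/3\<close>. Such covers are enough
  to induce the topology of a Tychonoff space.\<close>

definition threshold_cover :: "'a topology \<Rightarrow> ('a \<Rightarrow> real) \<Rightarrow> 'a set set" where
  "threshold_cover X g = {{y \<in> topspace X. g y < 2/3}, {y \<in> topspace X. g y > 1/3}}"

lemma threshold_cover_normal:
  assumes g: "continuous_map X euclideanreal g"
  shows "threshold_cover X g \<in> normal_covers X"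
proof (rule normal_covers_of_function[OF g, of "1/6"])
  fix x assume "x \<in> topspace X"
  show "\<exists>V\<in>threshold_cover X g. {y \<in> topspace X. \<bar>g y - g x\<bar> < 1/6} \<subseteq> V"
  proof (cases "g x \<le> 1/2")
    case True
    then have "{y \<in> topspace X. \<bar>g y - g x\<bar> < 1/6} \<subseteq> {y \<in> topspace X. g y < 2/3}" by (auto simp: abs_if split: if_splits)
    then show ?thesis by (auto simp: threshold_cover_def)
  next
    case False
    then have "{y \<in> topspace X. \<bar>g y - g x\<bar> < 1/6} \<subseteq> {y \<in> topspace X. g y > 1/3}" by (auto simp: abs_if split: if_splits)
    then show ?thesis by (auto simp: threshold_cover_def)
  qed
qed (auto simp: threshold_cover_def)

lemma threshold_cover_open:
  assumes g: "continuous_map X euclideanreal g" and "U \<in> threshold_cover X g"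
  shows "openin X U"
  using openin_continuous_map_preimage[OF g, of "{..<2/3}"]
    openin_continuous_map_preimage[OF g, of "{1/3<..}"] assms(2)
  by (auto simp: threshold_cover_def)

lemma tychonoff_threshold_cover:
  assumes "tychonoff_space X" "openin X S" "x \<in> S"
  obtains g where "continuous_map X euclideanreal g" "g x = 0" "{y \<in> topspace X. g y < 2/3} \<subseteq> S"
    "star {x} (threshold_cover X g) \<subseteq> S"
proof -
  have "closedin X (topspace X - S)" "x \<in> topspace X - (topspace X - S)"
    using assms openin_subset by auto
  then obtain g where g: "continuous_map X (top_of_set {0..1}) g" "g x = 0" "g ` (topspace X - S) \<subseteq> {1::real}"
    using assms(1) unfolding tychonoff_space_def completely_regular_space_def by metis
  have "continuous_map X euclideanreal g"
    using g(1) continuous_map_into_fulltopology by blast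
  moreover have "{y \<in> topspace X. g y < 2/3} \<subseteq> S"
    using g(3) by (force simp: image_subset_iff)
  moreover have "star {x} (threshold_cover X g) \<subseteq> {y \<in> topspace X. g y < 2/3}"
    using g(2) by (auto simp: star_def threshold_cover_def)
  ultimately show ?thesis using that g(2) by blast
qed

lemma uniformizable_by_normal_covers:
  assumes X: "tychonoff_space X"
  shows "uniformizable_by X (normal_covers X)"
proof -
  have 1: "{topspace X} \<in> normal_covers X"
    by (rule normal_coversI[of X "{{topspace X}}"]) (auto simp: normal_family_def star_refines_def star_def)
  have 2: "\<exists>\<W>\<in>normal_covers X. star_refines \<W> \<U> \<and> star_refines \<W> \<V>"
    if UV: "\<U> \<in> normal_covers X" "\<V> \<in> normal_covers X" for \<U> \<V>
  proof -
    obtain \<W> where "\<W>\<in>normal_covers X" "star_refines \<W> (meet \<U> \<V>)"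
      using normal_coversD(2)[OF normal_covers_meet[OF UV]] by blast
    then show ?thesis
      using cover_refines_meet[of \<U> \<V>]
      unfolding star_refines_def cover_refines_def by (meson subset_trans)
  qed
  have 3: "\<exists>\<U>\<in>normal_covers X. y \<notin> star {x} \<U>"
    if xy: "x \<in> topspace X" "y \<in> topspace X" "x \<noteq> y" for x y
  proof -
    obtain S where "openin X S" "x \<in> S" "y \<notin> S"
      using X xy unfolding tychonoff_space_def Hausdorff_space_def by (metis disjnt_iff)
    then obtain g where "continuous_map X euclideanreal g" "star {x} (threshold_cover X g) \<subseteq> S"
      using tychonoff_threshold_cover[OF X] by metis
    then show ?thesis using \<open>y \<notin> S\<close> threshold_cover_normal by blast
  qed
  have H: "hausdorff_uniformity (topspace X) (normal_covers X)"
    unfolding hausdorff_uniformity_def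
  proof (intro conjI ballI allI impI)
    show "normal_covers X \<noteq> {}" using 1 by (rule ex_in_conv[THEN iffD1, OF exI])
    show "\<V> \<in> normal_covers X"
      if "\<U> \<in> normal_covers X" "\<Union>\<V> = topspace X \<and> cover_refines \<U> \<V>" for \<U> \<V>
      using normal_covers_coarser that by (elim conjE)
  qed (use 2 3 normal_coversD(1) in simp_all)
  have "openin (uniform_topology (topspace X) (normal_covers X)) S \<longleftrightarrow> openin X S" for S
    unfolding openin_uniform_topology[OF H]
  proof
    assume S: "openin X S"
    show "S \<subseteq> topspace X \<and> (\<forall>x\<in>S. \<exists>\<U>\<in>normal_covers X. star {x} \<U> \<subseteq> S)"
      using openin_subset[OF S] tychonoff_threshold_cover[OF X S] threshold_cover_normal by metis
  next
    assume S: "S \<subseteq> topspace X \<and> (\<forall>x\<in>S. \<exists>\<U>\<in>normal_covers X. star {x} \<U> \<subseteq> S)"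
    show "openin X S"
    proof (subst openin_subopen, rule ballI)
      fix x assume "x \<in> S"
      then obtain \<U> where U: "\<U> \<in> normal_covers X" "star {x} \<U> \<subseteq> S" using S by blast
      obtain \<W> where W: "\<W> \<in> normal_covers X" "star_refines \<W> \<U>" "\<forall>W\<in>\<W>. openin X W"
        using normal_coversD(2)[OF U(1)] by blast
      have "star {x} \<W> \<subseteq> S"
        using star_mono_refines[OF star_refines_imp_cover_refines[OF W(2)], of "{x}"] U(2) by blast
      moreover have "x \<in> star {x} \<W>"
        using subset_star[of "{x}" \<W>] normal_coversD(1)[OF W(1)] S \<open>x \<in> S\<close> by blast
      ultimately show "\<exists>T. openin X T \<and> x \<in> T \<and> T \<subseteq> S"
        using openin_star[OF W(3)] by blast
    qed
  qed
  then show ?thesis using H by (simp add: uniformizable_by_def topology_eq)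
qed

lemma uniformizable_subset_normal_covers:
  assumes "uniformizable_by X \<mu>"
  shows "\<mu> \<subseteq> normal_covers X"
proof -
  have "normal_family X \<mu>"
    unfolding normal_family_def
    using uniform_open_star_refinement[OF assms] assms hausdorff_uniformityD(1)
    unfolding uniformizable_by_def by metis
  then show ?thesis by (auto intro: normal_coversI)
qed

lemma fine_uniformity_eq:
  assumes "tychonoff_space X"
  shows "fine_uniformity X = normal_covers X"
  unfolding fine_uniformity_def
  by (rule Greatest_equality) (use uniformizable_by_normal_covers[OF assms] uniformizable_subset_normal_covers in auto)

lemma star_finite_fine_uniformityI:
  assumes "tychonoff_space X" "\<U> \<in> normal_covers X" "star_finite \<U>" "\<forall>U\<in>\<U>. openin X U"
  shows "\<U> \<in> star_finite_fine_uniformity X"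
proof -
  have "cover_refines \<U> \<U>" by (auto simp: cover_refines_def)
  then show ?thesis
    using assms(2-4) normal_coversD(1)[OF assms(2)]
    unfolding star_finite_fine_uniformity_def fine_uniformity_eq[OF assms(1)] by (intro CollectI conjI bexI)
qed

lemma star_finite_fine_uniformityE:
  assumes "tychonoff_space X" "\<V> \<in> star_finite_fine_uniformity X"
  obtains \<U> where "\<U> \<in> normal_covers X" "star_finite \<U>" "\<forall>U\<in>\<U>. openin X U" "cover_refines \<U> \<V>"
proof -
  have "\<exists>\<U>\<in>normal_covers X. star_finite \<U> \<and> (\<forall>U\<in>\<U>. openin X U) \<and> cover_refines \<U> \<V>"
    using assms(2) unfolding star_finite_fine_uniformity_def fine_uniformity_eq[OF assms(1)]
    by (elim CollectE conjE)
  then show ?thesis using that by (elim bexE conjE)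
qed

lemma threshold_cover_star_finite_fine:
  assumes "tychonoff_space X" "continuous_map X euclideanreal g"
  shows "threshold_cover X g \<in> star_finite_fine_uniformity X"
proof (rule star_finite_fine_uniformityI)
  have "finite (threshold_cover X g)" by (simp add: threshold_cover_def)
  then show "star_finite (threshold_cover X g)"
    by (auto simp: star_finite_def)
qed (use assms threshold_cover_normal threshold_cover_open in auto)

text \<open>That the star-finite normal open covers generate a uniformity is not needed here: the sets which are
  neighbourhoods of their points in the sense of \<open>uniform_topology\<close> are identified directly with the
  open sets.\<close>

lemma uniform_topology_star_finite_fine:
  assumes X: "tychonoff_space X"
  shows "uniform_topology (topspace X) (star_finite_fine_uniformity X) = X"
proof -
  have "(S \<subseteq> topspace X \<and> (\<forall>x\<in>S. \<exists>\<U>\<in>star_finite_fine_uniformity X. star {x} \<U> \<subseteq> S)) \<longleftrightarrow> openin X S"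
    for S
  proof
    assume S: "openin X S"
    show "S \<subseteq> topspace X \<and> (\<forall>x\<in>S. \<exists>\<U>\<in>star_finite_fine_uniformity X. star {x} \<U> \<subseteq> S)"
      using openin_subset[OF S] tychonoff_threshold_cover[OF X S] threshold_cover_star_finite_fine[OF X]
      by metis
  next
    assume S: "S \<subseteq> topspace X \<and> (\<forall>x\<in>S. \<exists>\<U>\<in>star_finite_fine_uniformity X. star {x} \<U> \<subseteq> S)"
    show "openin X S"
    proof (subst openin_subopen, rule ballI)
      fix x assume "x \<in> S"
      then obtain \<V> where V: "\<V> \<in> star_finite_fine_uniformity X" "star {x} \<V> \<subseteq> S" using S by blast
      obtain \<U> where U: "\<U> \<in> normal_covers X" "\<forall>U\<in>\<U>. openin X U" "cover_refines \<U> \<V>"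
        using star_finite_fine_uniformityE[OF X V(1)] by metis
      have "x \<in> star {x} \<U>"
        using subset_star[of "{x}" \<U>] normal_coversD(1)[OF U(1)] S \<open>x \<in> S\<close> by blast
      then show "\<exists>T. openin X T \<and> x \<in> T \<and> T \<subseteq> S"
        using openin_star[OF U(2)] star_mono_refines[OF U(3), of "{x}"] V(2) by blast
    qed
  qed
  then have "(\<lambda>S. S \<subseteq> topspace X \<and> (\<forall>x\<in>S. \<exists>\<U>\<in>star_finite_fine_uniformity X. star {x} \<U> \<subseteq> S)) = openin X"
    by (intro ext)
  then show ?thesis by (simp add: uniform_topology_def openin_inverse)
qed

section \<open>Urysohn functions for normal covers\<close>

lemma dyadics_dense:
  fixes y z :: real
  assumes "0 \<le> y" "y < z"
  obtains s where "s \<in> dyadics" "y < s" "s < z"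
proof -
  obtain n q r where *: "real q / 2^n \<le> y" "y < real r / 2^n" "\<bar>real q / 2^n - real r / 2^n\<bar> < z - y"
    by (rule padic_rational_approximation_straddle_pos_le[of "z - y" 2 y]) (use assms in auto)
  then have "real r / 2^n < z" by linarith
  moreover have "real r / 2^n \<in> dyadics" unfolding dyadics_def by blast
  ultimately show ?thesis using that * by blast
qed

text \<open>\<open>A\<close> is uniformly inside \<open>B\<close> if \<open>B\<close> contains a star of \<open>A\<close> for some normal cover. The relation is transitive
  and interpolating, as the Urysohn construction requires.\<close>

definition uniformly_inside :: "'a topology \<Rightarrow> 'a set \<Rightarrow> 'a set \<Rightarrow> bool" where
  "uniformly_inside X A B \<longleftrightarrow> A \<subseteq> topspace X \<and> (\<exists>\<U>\<in>normal_covers X. star A \<U> \<subseteq> B)"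

lemma uniformly_inside_subset:
  assumes "uniformly_inside X A B"
  shows "A \<subseteq> B"
proof -
  obtain \<U> where U: "A \<subseteq> topspace X" "\<U> \<in> normal_covers X" "star A \<U> \<subseteq> B"
    using assms unfolding uniformly_inside_def by auto
  then show ?thesis using subset_star[of A \<U>] normal_coversD(1)[OF U(2)] by simp
qed

lemma uniformly_inside_trans:
  assumes "uniformly_inside X A B" "uniformly_inside X B C"
  shows "uniformly_inside X A C"
  using assms uniformly_inside_subset[OF assms(2)] unfolding uniformly_inside_def
  by (meson subset_trans)

lemma uniformly_inside_interpolate:
  assumes "uniformly_inside X A C"
  obtains B where "uniformly_inside X A B" "uniformly_inside X B C"
proof -
  obtain \<U> where U: "A \<subseteq> topspace X" "\<U> \<in> normal_covers X" "star A \<U> \<subseteq> C"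
    using assms unfolding uniformly_inside_def by auto
  obtain \<W> where W: "\<W> \<in> normal_covers X" "star_refines \<W> \<U>"
    using normal_coversD(2)[OF U(2)] by meson
  have "star A \<W> \<subseteq> topspace X"
    using normal_coversD(1)[OF W(1)] unfolding star_def by auto
  moreover have "star (star A \<W>) \<W> \<subseteq> C"
    using star_star_subset[OF W(2), of A] U(3) by (rule subset_trans)
  ultimately show ?thesis
    using that[of "star A \<W>"] U(1) W(1) unfolding uniformly_inside_def by auto
qed

lemma uniformly_inside_open_separation:
  assumes "uniformly_inside X C D" "x \<in> topspace X"
  obtains T where "openin X T" "x \<in> T" "x \<in> C \<longrightarrow> T \<subseteq> D" "x \<notin> D \<longrightarrow> T \<inter> C = {}"
proof -
  obtain \<U> where U: "C \<subseteq> topspace X" "\<U> \<in> normal_covers X" "star C \<U> \<subseteq> D"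
    using assms unfolding uniformly_inside_def by auto
  obtain \<W> where W: "\<W> \<in> normal_covers X" "star_refines \<W> \<U>" "\<forall>W\<in>\<W>. openin X W"
    using normal_coversD(2)[OF U(2)] by meson
  have CD: "star C \<W> \<subseteq> D"
    using star_mono_refines[OF star_refines_imp_cover_refines[OF W(2)], of C] U(3) by (rule subset_trans)
  obtain W where T: "W \<in> \<W>" "x \<in> W" "openin X W"
    using normal_coversD(1)[OF W(1)] assms(2) W(3) by (metis UnionE)
  have "W \<subseteq> D" if "W \<inter> C \<noteq> {}"
    using member_subset_star[OF T(1) that] CD by simp
  then show ?thesis using that[of W] T by blast
qed

text \<open>Interpolating along the dyadic rationals of the unit interval gives sets \<open>G r\<close> increasing from \<open>A\<close> to
  \<open>B\<close>, and \<open>f x\<close> is the infimum of the \<open>r\<close> with \<open>x \<in> G r\<close>.\<close>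

lemma uniform_Urysohn:
  assumes AB: "uniformly_inside X A B"
  obtains f :: "'a \<Rightarrow> real" where "continuous_map X euclideanreal f" "\<And>x. 0 \<le> f x" "\<And>x. f x \<le> 1"
    "\<And>x. x \<in> A \<Longrightarrow> f x = 0" "\<And>x. x \<notin> B \<Longrightarrow> f x = 1"
proof -
  have "\<exists>G :: real \<Rightarrow> 'a set. G 0 = A \<and> G 1 = B \<and>
      (\<forall>x \<in> dyadics \<inter> {0..1}. \<forall>y \<in> dyadics \<inter> {0..1}. x < y \<longrightarrow> uniformly_inside X (G x) (G y))"
  proof (rule recursion_on_dyadic_fractions)
    show "uniformly_inside X A B" by (fact AB)
    show "\<exists>B. uniformly_inside X A B \<and> uniformly_inside X B C" if "uniformly_inside X A C" for A C
      using uniformly_inside_interpolate[OF that] by metis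
  qed (rule uniformly_inside_trans)
  then obtain G :: "real \<Rightarrow> 'a set" where G0: "G 0 = A" and G1: "G 1 = B"
    and G: "\<And>x y. \<lbrakk>x \<in> dyadics; y \<in> dyadics; 0 \<le> x; x < y; y \<le> 1\<rbrakk> \<Longrightarrow> uniformly_inside X (G x) (G y)"
    by auto
  have Gsub: "G x \<subseteq> G y" if "x \<in> dyadics" "y \<in> dyadics" "0 \<le> x" "x \<le> y" "y \<le> 1" for x y
    using uniformly_inside_subset[OF G[of x y]] that by (cases "x = y") auto
  have d01: "(0::real) \<in> dyadics" "(1::real) \<in> dyadics" by (force simp: dyadics_def)+
  \<comment> \<open>The extra element \<open>1\<close> in the infimum gives \<open>f\<close> the value \<open>1\<close> at points in no \<open>G r\<close>.\<close>
  define S where "S x = {r \<in> dyadics \<inter> {0..1}. x \<in> G r}" for x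
  define f where "f x = Inf (insert 1 (S x))" for x
  have bdd: "bdd_below (insert 1 (S x))" for x by (auto simp: S_def bdd_below_def intro!: exI[of _ 0])
  have f_le: "f x \<le> r" if "r \<in> dyadics" "0 \<le> r" "r \<le> 1" "x \<in> G r" for x r
    unfolding f_def by (rule cInf_lower[OF _ bdd]) (use that in \<open>auto simp: S_def\<close>)
  have f_ge: "c \<le> f x" if "c \<le> 1" "\<And>r. \<lbrakk>r \<in> dyadics; 0 \<le> r; r \<le> 1; x \<in> G r\<rbrakk> \<Longrightarrow> c \<le> r" for x c
    unfolding f_def by (rule cInf_greatest) (use that in \<open>auto simp: S_def\<close>)
  have f0: "0 \<le> f x" for x by (rule f_ge) auto
  have f1: "f x \<le> 1" for x unfolding f_def by (rule cInf_lower[OF _ bdd]) simp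
  have "openin X {x \<in> topspace X. f x < a}" for a
  proof (subst openin_subopen, rule ballI)
    fix x assume x: "x \<in> {x \<in> topspace X. f x < a}"
    show "\<exists>T. openin X T \<and> x \<in> T \<and> T \<subseteq> {x \<in> topspace X. f x < a}"
    proof (cases "1 < a")
      case True
      then have "topspace X \<subseteq> {x \<in> topspace X. f x < a}" using f1 by (auto intro: le_less_trans)
      then show ?thesis using x by (intro exI[of _ "topspace X"]) auto
    next
      case False
      have "\<exists>r. r \<in> dyadics \<and> 0 \<le> r \<and> r \<le> 1 \<and> x \<in> G r \<and> r < a"
      proof (rule ccontr)
        assume "\<not> ?thesis"
        then have "a \<le> f x" by (intro f_ge) (use False in force)+
        then show False using x by simp
      qed
      then obtain r where r: "r \<in> dyadics" "0 \<le> r" "r \<le> 1" "x \<in> G r" "r < a" by blast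
      obtain s where s: "s \<in> dyadics" "r < s" "s < a" using dyadics_dense[OF r(2,5)] .
      have "uniformly_inside X (G r) (G s)" using G r s False by simp
      then obtain T where T: "openin X T" "x \<in> T" "T \<subseteq> G s"
        using uniformly_inside_open_separation[of X "G r" "G s" x] x r(4) by auto
      have "f y < a" if "y \<in> T" for y
        using f_le[of s y] T(3) that s r False by auto
      then show ?thesis using T openin_subset[OF T(1)] by blast
    qed
  qed
  moreover have "openin X {x \<in> topspace X. f x > a}" for a
  proof (subst openin_subopen, rule ballI)
    fix x assume x: "x \<in> {x \<in> topspace X. f x > a}"
    show "\<exists>T. openin X T \<and> x \<in> T \<and> T \<subseteq> {x \<in> topspace X. f x > a}"
    proof (cases "a < 0")
      case True
      then have "topspace X \<subseteq> {x \<in> topspace X. f x > a}" using f0 by (auto intro: less_le_trans)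
      then show ?thesis using x by (intro exI[of _ "topspace X"]) auto
    next
      case False
      then obtain r where r: "r \<in> dyadics" "a < r" "r < f x" using dyadics_dense[of a "f x"] x by auto
      then obtain s where s: "s \<in> dyadics" "r < s" "s < f x" using dyadics_dense[of r "f x"] False by auto
      have le: "s \<le> 1" "0 \<le> r" using s f1[of x] r False by auto
      have "x \<notin> G s" using f_le[of s x] s r le by force
      moreover have "uniformly_inside X (G r) (G s)" using G r s le by simp
      ultimately obtain T where T: "openin X T" "x \<in> T" "T \<inter> G r = {}"
        using uniformly_inside_open_separation[of X "G r" "G s" x] x by auto
      have "a < f y" if "y \<in> T" for y
      proof -
        have "r \<le> f y"
        proof (rule f_ge)
          fix t assume t: "t \<in> dyadics" "0 \<le> t" "t \<le> 1" "y \<in> G t"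
          show "r \<le> t"
          proof (rule ccontr)
            assume "\<not> r \<le> t"
            then have "G t \<subseteq> G r" using Gsub[of t r] t r s le by auto
            then show False using T(3) \<open>y \<in> T\<close> t by blast
          qed
        qed (use s le in simp)
        then show ?thesis using r by simp
      qed
      then show ?thesis using T openin_subset[OF T(1)] by blast
    qed
  qed
  ultimately have "continuous_map X euclideanreal f"
    by (simp add: continuous_map_upper_lower_semicontinuous_lt)
  moreover have "f x = 0" if "x \<in> A" for x
    using f_le[of 0 x] f0[of x] d01 that G0 by simp
  moreover have "f x = 1" if "x \<notin> B" for x
  proof (rule antisym[OF f1], rule f_ge)
    fix r :: real assume r: "r \<in> dyadics" "0 \<le> r" "r \<le> 1" "x \<in> G r"
    then show "1 \<le> r" using Gsub[of r 1] G1 d01 that by auto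
  qed simp
  ultimately show ?thesis using that f0 f1 by blast
qed

text \<open>The members of a normal cover contain uniformly smaller sets that still cover the space.\<close>

lemma normal_cover_subordinate_functions:
  assumes "\<U> \<in> normal_covers X"
  obtains f :: "'a set \<Rightarrow> 'a \<Rightarrow> real" where
    "\<And>U. U \<in> \<U> \<Longrightarrow> continuous_map X euclideanreal (f U)"
    "\<And>U x. U \<in> \<U> \<Longrightarrow> 0 \<le> f U x"
    "\<And>U x. U \<in> \<U> \<Longrightarrow> x \<notin> U \<Longrightarrow> f U x = 0"
    "\<And>x. x \<in> topspace X \<Longrightarrow> \<exists>U\<in>\<U>. f U x = 1"
proof -
  obtain \<W> where W: "\<W> \<in> normal_covers X" "star_refines \<W> \<U>"
    using normal_coversD(2)[OF assms] by meson
  \<comment> \<open>These sets cover the space since \<open>\<W>\<close> star-refines \<open>\<U>\<close>.\<close>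
  define A where "A U = {x \<in> topspace X. star {x} \<W> \<subseteq> U}" for U
  have ex: "\<exists>g :: 'a \<Rightarrow> real. continuous_map X euclideanreal g \<and> (\<forall>x. 0 \<le> g x) \<and>
      (\<forall>x. x \<notin> U \<longrightarrow> g x = 0) \<and> (\<forall>x\<in>A U. g x = 1)" for U
  proof -
    have "star (A U) \<W> \<subseteq> U"
    proof
      fix y assume "y \<in> star (A U) \<W>"
      then obtain V x where "V \<in> \<W>" "y \<in> V" "x \<in> V" "x \<in> A U" by (auto simp: star_def)
      then show "y \<in> U" using member_subset_star[of V \<W> "{x}"] by (auto simp: A_def)
    qed
    then have "uniformly_inside X (A U) U"
      unfolding uniformly_inside_def using W(1) by (auto simp: A_def)
    then obtain f :: "'a \<Rightarrow> real" where f: "continuous_map X euclideanreal f" "\<And>x. f x \<le> 1"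
      "\<And>x. x \<in> A U \<Longrightarrow> f x = 0" "\<And>x. x \<notin> U \<Longrightarrow> f x = 1"
      using uniform_Urysohn by metis
    have "continuous_map X euclideanreal (\<lambda>x. 1 - f x)"
      using f(1) by (intro continuous_intros) auto
    then show ?thesis using f(2-) by (intro exI[of _ "\<lambda>x. 1 - f x"]) auto
  qed
  then obtain f :: "'a set \<Rightarrow> 'a \<Rightarrow> real" where
    f: "\<And>U. continuous_map X euclideanreal (f U) \<and> (\<forall>x. 0 \<le> f U x) \<and>
      (\<forall>x. x \<notin> U \<longrightarrow> f U x = 0) \<and> (\<forall>x\<in>A U. f U x = 1)"
    by metis
  have "\<exists>U\<in>\<U>. f U x = 1" if x: "x \<in> topspace X" for x
  proof -
    obtain V where V: "V \<in> \<W>" "x \<in> V" using normal_coversD(1)[OF W(1)] x by (metis UnionE)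
    then obtain U where U: "U \<in> \<U>" "star V \<W> \<subseteq> U" using W(2) unfolding star_refines_def by metis
    have "star {x} \<W> \<subseteq> U" using star_mono[of "{x}" V \<W>] V(2) U(2) by simp
    then have "x \<in> A U" using x by (simp add: A_def)
    then show ?thesis using f U(1) by blast
  qed
  then show ?thesis using that[of f] f by simp
qed

section \<open>The intersection graph of a cover\<close>

text \<open>The edges of the intersection graph: two members are adjacent if they meet. An empty member is isolated.\<close>

definition adjacency :: "'a set set \<Rightarrow> ('a set \<times> 'a set) set" where
  "adjacency \<U> = {(V, W). V \<in> \<U> \<and> W \<in> \<U> \<and> V \<inter> W \<noteq> {}}"

text \<open>A vertex chosen in the connected component of \<open>V\<close>; it depends on the component only (\<open>root_eq\<close>).\<close>

definition root :: "'a set set \<Rightarrow> 'a set \<Rightarrow> 'a set" where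
  "root \<U> V = (SOME W. (W, V) \<in> (adjacency \<U>)\<^sup>*)"

text \<open>The distance of \<open>V\<close> from the root of its component.\<close>

definition rank :: "'a set set \<Rightarrow> 'a set \<Rightarrow> nat" where
  "rank \<U> V = (LEAST n. (root \<U> V, V) \<in> adjacency \<U> ^^ n)"

lemma adjacencyI: "V \<in> \<U> \<Longrightarrow> W \<in> \<U> \<Longrightarrow> x \<in> V \<Longrightarrow> x \<in> W \<Longrightarrow> (V, W) \<in> adjacency \<U>"
  by (auto simp: adjacency_def)

lemma sym_adjacency: "(V, W) \<in> adjacency \<U> \<Longrightarrow> (W, V) \<in> adjacency \<U>"
  by (auto simp: adjacency_def)

lemma root_eq: "(V, W) \<in> adjacency \<U> \<Longrightarrow> root \<U> V = root \<U> W"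
  unfolding root_def by (meson rtrancl.rtrancl_into_rtrancl sym_adjacency)

lemma root_path: "(root \<U> V, V) \<in> adjacency \<U> ^^ rank \<U> V"
proof -
  have "(root \<U> V, V) \<in> (adjacency \<U>)\<^sup>*"
    unfolding root_def by (rule someI[of "\<lambda>W. (W, V) \<in> (adjacency \<U>)\<^sup>*" V]) simp
  then have "\<exists>n. (root \<U> V, V) \<in> adjacency \<U> ^^ n" by (rule rtrancl_imp_relpow)
  then show ?thesis unfolding rank_def by (rule LeastI_ex)
qed

lemma rank_adjacent:
  assumes "(V, W) \<in> adjacency \<U>"
  shows "rank \<U> W \<le> Suc (rank \<U> V)"
proof -
  have "(root \<U> W, W) \<in> adjacency \<U> ^^ Suc (rank \<U> V)"
    using root_path[of \<U> V] assms root_eq[OF assms] by auto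
  then show ?thesis unfolding rank_def[of \<U> W] by (rule Least_le)
qed

lemma root_mem:
  assumes "V \<in> \<U>" shows "root \<U> V \<in> \<U>"
proof (cases "rank \<U> V")
  case 0
  then show ?thesis using root_path[of \<U> V] assms by simp
next
  case (Suc n)
  then show ?thesis using root_path[of \<U> V] relpow_Suc_D2[of "root \<U> V" V n "adjacency \<U>"]
    by (auto simp: adjacency_def)
qed

lemma path_subset_star_iter: "(R, V) \<in> adjacency \<U> ^^ n \<Longrightarrow> V \<subseteq> star_iter n R \<U>"
proof (induction n arbitrary: V)
  case (Suc n)
  then obtain W where W: "(R, W) \<in> adjacency \<U> ^^ n" "(W, V) \<in> adjacency \<U>" by auto
  have "V \<in> \<U>" "V \<inter> star_iter n R \<U> \<noteq> {}"
    using Suc.IH[OF W(1)] W(2) by (auto simp: adjacency_def)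
  then show ?case using member_subset_star by simp
qed simp

lemma finite_path_ends:
  assumes "star_finite \<U>"
  shows "finite {V. (R, V) \<in> adjacency \<U> ^^ n}"
proof (induction n)
  case (Suc n)
  have fin: "finite {V. (W, V) \<in> adjacency \<U>}" for W
  proof (cases "W \<in> \<U>")
    case True
    then have "finite {V \<in> \<U>. W \<inter> V \<noteq> {}}" using assms unfolding star_finite_def by (rule bspec[rotated])
    then show ?thesis by (rule rev_finite_subset) (auto simp: adjacency_def)
  qed (simp add: adjacency_def)
  have "{V. (R, V) \<in> adjacency \<U> ^^ Suc n} = (\<Union>W\<in>{W. (R, W) \<in> adjacency \<U> ^^ n}. {V. (W, V) \<in> adjacency \<U>})"
    by auto
  then show ?case using Suc fin by simp
qed simp

lemma countable_component:
  assumes "star_finite \<U>"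
  shows "countable {V \<in> \<U>. root \<U> V = R}"
proof (rule countable_subset)
  show "{V \<in> \<U>. root \<U> V = R} \<subseteq> (\<Union>n. {V. (R, V) \<in> adjacency \<U> ^^ n})"
    using root_path[of \<U>] by auto
  show "countable (\<Union>n. {V. (R, V) \<in> adjacency \<U> ^^ n})"
    using finite_path_ends[OF assms] by (intro countable_UN) (auto intro: countable_finite)
qed

section \<open>From Bourbaki-completeness to \<open>\<delta>\<close>-completeness\<close>

lemma delta_complete_iff:
  assumes "tychonoff_space X"
  shows "delta_complete X \<longleftrightarrow>
    (\<forall>F. cauchy_filter (topspace X) (star_finite_fine_uniformity X) F \<longrightarrow> (\<exists>x. limitin X id x F))"
  unfolding delta_complete_def complete_uniformity_def uniform_topology_star_finite_fine[OF assms] ..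

text \<open>If \<open>x\<close> is a cluster point and \<open>g\<close> separates \<open>x\<close> from the complement of an open set, then the member of the
  threshold cover of \<open>g\<close> that belongs to the filter must be the one around \<open>x\<close>.\<close>

lemma star_finite_fine_cauchy_cluster_limit:
  assumes X: "tychonoff_space X"
    and F: "cauchy_filter (topspace X) (star_finite_fine_uniformity X) F"
    and x: "cluster_point_of X F x"
  shows "limitin X id x F"
  unfolding limitin_def id_apply
proof (intro conjI allI impI)
  have "eventually (\<lambda>y. y \<in> topspace X) F"
    using F unfolding cauchy_filter_def filter_on_def le_principal by simp
  then have "x \<in> X closure_of topspace X" using x unfolding cluster_point_of_def by blast
  then show xX: "x \<in> topspace X" by simp
  fix S assume "openin X S \<and> x \<in> S"
  then obtain g where g: "continuous_map X euclideanreal g" "g x = 0" "{y \<in> topspace X. g y < 2/3} \<subseteq> S"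
    using tychonoff_threshold_cover[OF X] by metis
  have "\<exists>U\<in>threshold_cover X g. eventually (\<lambda>y. y \<in> U) F"
    using F threshold_cover_star_finite_fine[OF X g(1)] unfolding cauchy_filter_def by simp
  then consider "eventually (\<lambda>y. y \<in> {y \<in> topspace X. g y < 2/3}) F"
    | "eventually (\<lambda>y. y \<in> {y \<in> topspace X. g y > 1/3}) F"
    unfolding threshold_cover_def by auto
  then show "eventually (\<lambda>y. y \<in> S) F"
  proof cases
    case 1
    then show ?thesis by (rule eventually_mono) (use g(3) in blast)
  next
    case 2
    then have "x \<in> X closure_of {y \<in> topspace X. g y > 1/3}"
      using x unfolding cluster_point_of_def by blast
    moreover have "openin X {y \<in> topspace X. g y < 1/3}"
      using openin_continuous_map_preimage[OF g(1), of "{..<1/3}"] by simp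
    ultimately have "\<exists>y\<in>{y \<in> topspace X. g y > 1/3}. y \<in> {y \<in> topspace X. g y < 1/3}"
      using xX g(2) unfolding in_closure_of
      by (elim conjE allE[of _ "{y \<in> topspace X. g y < 1/3}"]) (auto simp del: bex_simps)
    then have False by auto
    then show ?thesis ..
  qed
qed

lemma star_iter_mono:
  assumes "A \<subseteq> B" "cover_refines \<U> \<V>"
  shows "star_iter n A \<U> \<subseteq> star_iter n B \<V>"
proof (induction n)
  case (Suc n)
  then show ?case
    using star_mono[OF Suc, of \<U>] star_mono_refines[OF assms(2), of "star_iter n B \<V>"] by simp
qed (simp add: assms)

text \<open>The union of all members of \<open>\<U>\<close> at distance \<open>n\<close> from the root \<open>R\<close>.\<close>

definition layer :: "'a set set \<Rightarrow> 'a set \<Rightarrow> nat \<Rightarrow> 'a set" where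
  "layer \<U> R n = \<Union>{V \<in> \<U>. root \<U> V = R \<and> rank \<U> V = n}"

text \<open>All layers of all components of the intersection graph.\<close>

definition layer_cover :: "'a set set \<Rightarrow> 'a set set" where
  "layer_cover \<U> = (\<lambda>V. layer \<U> (root \<U> V) (rank \<U> V)) ` \<U>"

lemma subset_layer: "V \<in> \<U> \<Longrightarrow> V \<subseteq> layer \<U> (root \<U> V) (rank \<U> V)"
  by (auto simp: layer_def)

lemma Union_layer_cover: "\<Union>(layer_cover \<U>) = \<Union>\<U>"
proof
  show "\<Union>\<U> \<subseteq> \<Union>(layer_cover \<U>)" using subset_layer unfolding layer_cover_def by blast
  show "\<Union>(layer_cover \<U>) \<subseteq> \<Union>\<U>" by (auto simp: layer_cover_def layer_def)
qed

lemma cover_refines_layer_cover: "cover_refines \<U> (layer_cover \<U>)"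
  unfolding cover_refines_def layer_cover_def using subset_layer by blast

text \<open>A layer meets only layers of the same component whose ranks differ by at most one.\<close>

lemma star_finite_layer_cover: "star_finite (layer_cover \<U>)"
  unfolding star_finite_def
proof
  fix L assume "L \<in> layer_cover \<U>"
  then obtain R n where L: "L = layer \<U> R n" by (auto simp: layer_cover_def)
  have "{W \<in> layer_cover \<U>. L \<inter> W \<noteq> {}} \<subseteq> layer \<U> R ` {..Suc n}"
  proof
    fix W assume "W \<in> {W \<in> layer_cover \<U>. L \<inter> W \<noteq> {}}"
    then obtain R' m where W: "W = layer \<U> R' m" "layer \<U> R n \<inter> layer \<U> R' m \<noteq> {}"
      by (auto simp: layer_cover_def L)
    then obtain x V V' where "V \<in> \<U>" "V' \<in> \<U>" "x \<in> V" "x \<in> V'"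
      "root \<U> V = R" "rank \<U> V = n" "root \<U> V' = R'" "rank \<U> V' = m"
      by (auto simp: layer_def)
    then have "R' = R" "m \<le> Suc n"
      using root_eq[OF adjacencyI, of V \<U> V' x] rank_adjacent[OF adjacencyI, of V \<U> V' x] by auto
    then show "W \<in> layer \<U> R ` {..Suc n}" using W(1) by simp
  qed
  then show "finite {W \<in> layer_cover \<U>. L \<inter> W \<noteq> {}}" by (rule finite_subset) simp
qed

lemma layer_subset_star_iter: "layer \<U> R n \<subseteq> star_iter n R \<U>"
proof
  fix x assume "x \<in> layer \<U> R n"
  then obtain V where "V \<in> \<U>" "root \<U> V = R" "rank \<U> V = n" "x \<in> V" by (auto simp: layer_def)
  then show "x \<in> star_iter n R \<U>"
    using path_subset_star_iter[OF root_path[of \<U> V]] by (simp add: subset_iff)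
qed

lemma star_finite_fine_cauchy_imp_bourbaki_cauchy:
  assumes X: "tychonoff_space X" and \<mu>: "uniformizable_by X \<mu>"
    and F: "cauchy_filter (topspace X) (star_finite_fine_uniformity X) F"
  shows "bourbaki_cauchy_filter (topspace X) \<mu> F"
  unfolding bourbaki_cauchy_filter_def
proof (intro conjI ballI)
  show "filter_on (topspace X) F" using F by (simp add: cauchy_filter_def)
  fix \<V> assume "\<V> \<in> \<mu>"
  then obtain \<U> where U: "\<U> \<in> \<mu>" "star_refines \<U> \<V>" "\<forall>U\<in>\<U>. openin X U"
    using uniform_open_star_refinement[OF \<mu>] by metis
  have H: "hausdorff_uniformity (topspace X) \<mu>" using \<mu> by (simp add: uniformizable_by_def)
  have "layer_cover \<U> \<in> \<mu>"
    using hausdorff_uniformityD(2)[OF H U(1) _ cover_refines_layer_cover]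
      hausdorff_uniformityD(1)[OF H U(1)] by (simp add: Union_layer_cover)
  then have "layer_cover \<U> \<in> normal_covers X" using uniformizable_subset_normal_covers[OF \<mu>] by blast
  moreover have "\<forall>L\<in>layer_cover \<U>. openin X L"
    using U(3) by (auto simp: layer_cover_def layer_def)
  ultimately have "layer_cover \<U> \<in> star_finite_fine_uniformity X"
    by (intro star_finite_fine_uniformityI[OF X] star_finite_layer_cover)
  then obtain L where "L \<in> layer_cover \<U>" and L: "eventually (\<lambda>x. x \<in> L) F"
    using F unfolding cauchy_filter_def by (meson bspec)
  then obtain V where V: "V \<in> \<U>" "L = layer \<U> (root \<U> V) (rank \<U> V)" by (auto simp: layer_cover_def)
  obtain W where W: "W \<in> \<V>" "root \<U> V \<subseteq> W"
    using star_refines_imp_cover_refines[OF U(2)] root_mem[OF V(1)] unfolding cover_refines_def by metis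
  have "L \<subseteq> star_iter (rank \<U> V) W \<V>"
    using layer_subset_star_iter star_iter_mono[OF W(2) star_refines_imp_cover_refines[OF U(2)]]
    unfolding V(2) by (rule subset_trans)
  then have "eventually (\<lambda>x. x \<in> star_iter (rank \<U> V) W \<V>) F"
    by (intro eventually_mono[OF L]) (rule subsetD)
  then show "\<exists>m. \<exists>U\<in>\<V>. eventually (\<lambda>x. x \<in> star_iter m U \<V>) F" using W(1) by blast
qed

lemma bourbaki_complete_imp_delta_complete:
  assumes X: "tychonoff_space X" and \<mu>: "uniformizable_by X \<mu>" "bourbaki_complete (topspace X) \<mu>"
  shows "delta_complete X"
  unfolding delta_complete_iff[OF X]
proof (intro allI impI)
  fix F assume F: "cauchy_filter (topspace X) (star_finite_fine_uniformity X) F"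
  have "\<exists>x. cluster_point_of (uniform_topology (topspace X) \<mu>) F x"
    using star_finite_fine_cauchy_imp_bourbaki_cauchy[OF X \<mu>(1) F] \<mu>(2)
    unfolding bourbaki_complete_def by blast
  moreover have "uniform_topology (topspace X) \<mu> = X" using \<mu>(1) by (simp add: uniformizable_by_def)
  ultimately show "\<exists>x. limitin X id x F"
    using star_finite_fine_cauchy_cluster_limit[OF X F] by auto
qed

section \<open>Convergence along clopen partitions and real functions\<close>

text \<open>A filter converges if it selects a member of every partition into open sets and all continuous real
  functions converge along it.\<close>

definition function_complete :: "'a topology \<Rightarrow> bool" where
  "function_complete X \<longleftrightarrow>
     (\<forall>F. filter_on (topspace X) F \<longrightarrow>
       (\<forall>\<P>. open_partition X \<P> \<longrightarrow> (\<exists>P\<in>\<P>. eventually (\<lambda>x. x \<in> P) F)) \<longrightarrow>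
       (\<forall>g. continuous_map X euclideanreal g \<longrightarrow> (\<exists>l. (g \<longlongrightarrow> l) F)) \<longrightarrow>
       (\<exists>x. limitin X id x F))"

text \<open>The unions of the components of the intersection graph partition the space; the empty member of
  the cover, being a component of its own, is left out.\<close>

lemma open_partition_components:
  assumes "\<Union>\<U> = topspace X" "\<forall>U\<in>\<U>. openin X U"
  shows "open_partition X ((\<lambda>V. \<Union>{W \<in> \<U>. root \<U> W = root \<U> V}) ` {V \<in> \<U>. V \<noteq> {}})"
  (is "open_partition X (?C ` _)")
  unfolding open_partition_def partition_on_def disjoint_def
proof (intro conjI ballI impI)
  have sub: "V \<subseteq> ?C V" if "V \<in> \<U>" for V using that by auto
  show "\<Union>(?C ` {V \<in> \<U>. V \<noteq> {}}) = topspace X"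
  proof
    show "\<Union>(?C ` {V \<in> \<U>. V \<noteq> {}}) \<subseteq> topspace X" using assms(1) by auto
    show "topspace X \<subseteq> \<Union>(?C ` {V \<in> \<U>. V \<noteq> {}})"
    proof
      fix x assume "x \<in> topspace X"
      then obtain V where "V \<in> \<U>" "x \<in> V" using assms(1) by (metis UnionE)
      then show "x \<in> \<Union>(?C ` {V \<in> \<U>. V \<noteq> {}})" using sub[of V] by auto
    qed
  qed
  show "{} \<notin> ?C ` {V \<in> \<U>. V \<noteq> {}}" using sub by fastforce
  show "openin X P" if "P \<in> ?C ` {V \<in> \<U>. V \<noteq> {}}" for P using that assms(2) by auto
  show "P \<inter> Q = {}" if PQ: "P \<in> ?C ` {V \<in> \<U>. V \<noteq> {}}" "Q \<in> ?C ` {V \<in> \<U>. V \<noteq> {}}" "P \<noteq> Q" for P Q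
  proof (rule ccontr)
    obtain V V' where VV: "P = ?C V" "Q = ?C V'" using PQ by auto
    assume "P \<inter> Q \<noteq> {}"
    then obtain x W W' where "W \<in> \<U>" "W' \<in> \<U>" "x \<in> W" "x \<in> W'"
      "root \<U> W = root \<U> V" "root \<U> W' = root \<U> V'"
      unfolding VV by auto
    then have "root \<U> V = root \<U> V'" using root_eq[OF adjacencyI, of W \<U> W' x] by simp
    then show False using PQ(3) VV by simp
  qed
qed

text \<open>On a member \<open>U\<close> of the cover the sum ranges over the finitely many members that meet \<open>U\<close>.\<close>

lemma continuous_map_star_finite_sum:
  fixes c :: "'a set \<Rightarrow> 'a \<Rightarrow> real"
  assumes un: "\<Union>\<U> = topspace X" and op: "\<forall>U\<in>\<U>. openin X U" and sf: "star_finite \<U>"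
    and cont: "\<And>V. V \<in> \<U> \<Longrightarrow> continuous_map X euclideanreal (c V)"
    and off: "\<And>V x. V \<in> \<U> \<Longrightarrow> x \<notin> V \<Longrightarrow> c V x = 0"
  shows "continuous_map X euclideanreal (\<lambda>x. \<Sum>V | V \<in> \<U> \<and> x \<in> V. c V x)"
proof (rule pasting_lemma[where I=\<U> and T="\<lambda>U. U" and f="\<lambda>U x. \<Sum>V | V \<in> \<U> \<and> U \<inter> V \<noteq> {}. c V x"])
  have fin: "finite {V \<in> \<U>. U \<inter> V \<noteq> {}}" if "U \<in> \<U>" for U
    using sf that unfolding star_finite_def by (rule bspec)
  have eq: "(\<Sum>V | V \<in> \<U> \<and> x \<in> V. c V x) = (\<Sum>V | V \<in> \<U> \<and> U \<inter> V \<noteq> {}. c V x)"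
    if "U \<in> \<U>" "x \<in> U" for U x
    by (rule sum.mono_neutral_left) (use fin[OF that(1)] off that in auto)
  show "continuous_map (subtopology X U) euclideanreal (\<lambda>x. \<Sum>V | V \<in> \<U> \<and> U \<inter> V \<noteq> {}. c V x)"
    if "U \<in> \<U>" for U
    using fin[OF that] cont by (intro continuous_map_from_subtopology continuous_map_sum) auto
  show "openin X U" if "U \<in> \<U>" for U using op that by blast
  show "(\<Sum>V | V \<in> \<U> \<and> U \<inter> V \<noteq> {}. c V x) = (\<Sum>V | V \<in> \<U> \<and> U' \<inter> V \<noteq> {}. c V x)"
    if "U \<in> \<U>" "U' \<in> \<U>" "x \<in> topspace X \<inter> U \<inter> U'" for U U' x
    using eq[of U x] eq[of U' x] that by simp
  show "\<exists>U. U \<in> \<U> \<and> x \<in> U \<and>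
      (\<Sum>V | V \<in> \<U> \<and> x \<in> V. c V x) = (\<Sum>V | V \<in> \<U> \<and> U \<inter> V \<noteq> {}. c V x)"
    if "x \<in> topspace X" for x
  proof -
    obtain U where "U \<in> \<U>" "x \<in> U" using un \<open>x \<in> topspace X\<close> by (metis UnionE)
    then show ?thesis using eq by blast
  qed
qed

text \<open>The key step from \<open>\<delta>\<close>-completeness to \<open>function_complete\<close>: partitions and real functions decide which
  member of a star-finite normal open cover belongs to the filter.\<close>

lemma eventually_in_member:
  fixes F :: "'a filter"
  assumes U: "\<U> \<in> normal_covers X" "star_finite \<U>" "\<forall>U\<in>\<U>. openin X U"
    and F: "filter_on (topspace X) F"
    and part: "\<And>\<P>. open_partition X \<P> \<Longrightarrow> \<exists>P\<in>\<P>. eventually (\<lambda>x. x \<in> P) F"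
    and lim: "\<And>g. continuous_map X euclideanreal g \<Longrightarrow> \<exists>l. (g \<longlongrightarrow> l) F"
  shows "\<exists>U\<in>\<U>. eventually (\<lambda>x. x \<in> U) F"
proof -
  note un = normal_coversD(1)[OF U(1)]
  have F0: "F \<noteq> bot" and FX: "eventually (\<lambda>x. x \<in> topspace X) F"
    using F unfolding filter_on_def le_principal by auto
  obtain R where R: "eventually (\<lambda>x. x \<in> \<Union>{W \<in> \<U>. root \<U> W = R}) F"
    using part[OF open_partition_components[OF un U(3)]] by auto
  define \<K> where "\<K> = {W \<in> \<U>. root \<U> W = R}"
  define \<nu> where "\<nu> = to_nat_on \<K>"
  have inj: "inj_on \<nu> \<K>"
    unfolding \<nu>_def \<K>_def by (rule inj_on_to_nat_on[OF countable_component[OF U(2)]])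
  obtain f :: "'a set \<Rightarrow> 'a \<Rightarrow> real" where
    f: "\<And>U. U \<in> \<U> \<Longrightarrow> continuous_map X euclideanreal (f U)" "\<And>U x. U \<in> \<U> \<Longrightarrow> 0 \<le> f U x"
      "\<And>U x. U \<in> \<U> \<Longrightarrow> x \<notin> U \<Longrightarrow> f U x = 0" "\<And>x. x \<in> topspace X \<Longrightarrow> \<exists>U\<in>\<U>. f U x = 1"
    using normal_cover_subordinate_functions[OF U(1)] by metis
  define c where "c V x = (if V \<in> \<K> then real (\<nu> V) * f V x else 0)" for V x
  \<comment> \<open>On the component \<open>\<K>\<close>, a bound \<open>h x < l + 1\<close> leaves only the finitely many members with \<open>\<nu> V < l + 1\<close>
    as candidates for \<open>f V x = 1\<close>.\<close>
  define h where "h x = (\<Sum>V | V \<in> \<U> \<and> x \<in> V. c V x)" for x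
  have "continuous_map X euclideanreal h"
    unfolding h_def
  proof (rule continuous_map_star_finite_sum[OF un U(3,2)])
    show "continuous_map X euclideanreal (c V)" if "V \<in> \<U>" for V
      using f(1)[OF that] unfolding c_def
      by (cases "V \<in> \<K>") (auto intro: continuous_map_real_mult_left)
  qed (simp add: c_def f(3))
  then obtain l where "(h \<longlongrightarrow> l) F" using lim by blast
  then have hl: "eventually (\<lambda>x. h x < l + 1) F" by (rule order_tendstoD) simp
  define \<G> where "\<G> = {V \<in> \<K>. real (\<nu> V) < l + 1}"
  have fin: "finite \<G>"
  proof (rule inj_on_finite)
    show "inj_on \<nu> \<G>" using inj by (rule inj_on_subset) (auto simp: \<G>_def)
    show "\<nu> ` \<G> \<subseteq> {..nat \<lceil>l + 1\<rceil>}" by (auto simp: \<G>_def) linarith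
  qed simp
  have ev: "eventually (\<lambda>x. \<exists>V\<in>\<G>. f V x = 1) F"
    using FX R hl
  proof eventually_elim
    case (elim x)
    obtain W where W: "W \<in> \<U>" "root \<U> W = R" "x \<in> W" using elim(2) by blast
    obtain V where V: "V \<in> \<U>" "f V x = 1" using f(4) elim(1) by blast
    then have "x \<in> V" using f(3)[OF V(1), of x] by force
    then have "root \<U> V = R" using root_eq[OF adjacencyI, of V \<U> W x] V W by simp
    then have VK: "V \<in> \<K>" using V by (simp add: \<K>_def)
    have "finite {V \<in> \<U>. W \<inter> V \<noteq> {}}" using U(2) W(1) unfolding star_finite_def by (rule bspec)
    then have "finite {V \<in> \<U>. x \<in> V}" by (rule rev_finite_subset) (use W(3) in auto)
    then have "c V x \<le> h x"
      unfolding h_def using V(1) \<open>x \<in> V\<close> f(2) by (intro member_le_sum) (auto simp: c_def \<K>_def)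
    then have "real (\<nu> V) < l + 1" using VK V(2) elim(3) by (simp add: c_def)
    then show ?case using VK V(2) by (auto simp: \<G>_def)
  qed
  \<comment> \<open>Not all of these finitely many functions can have a limit below \<open>1\<close>.\<close>
  have "\<exists>V\<in>\<G>. \<exists>l>0. (f V \<longlongrightarrow> l) F"
  proof (rule ccontr)
    assume not: "\<not> ?thesis"
    have "eventually (\<lambda>x. f V x < 1) F" if "V \<in> \<G>" for V
    proof -
      have "V \<in> \<U>" using that by (simp add: \<G>_def \<K>_def)
      then obtain l where l: "(f V \<longlongrightarrow> l) F" using lim f(1) by blast
      then have "\<not> 0 < l" using not that by blast
      then have "l < 1" by simp
      then show ?thesis using order_tendstoD(2)[OF l] by blast
    qed
    then have "eventually (\<lambda>x. \<forall>V\<in>\<G>. f V x < 1) F" using fin by (simp add: eventually_ball_finite)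
    with ev have "eventually (\<lambda>x. False) F" by eventually_elim fastforce
    then show False using F0 by (simp add: trivial_limit_def)
  qed
  then obtain V l where V: "V \<in> \<U>" "l > 0" "(f V \<longlongrightarrow> l) F" by (auto simp: \<G>_def \<K>_def)
  then have "eventually (\<lambda>x. 0 < f V x) F" by (intro order_tendstoD(1))
  then have "eventually (\<lambda>x. x \<in> V) F" by (rule eventually_mono) (use f(3)[OF V(1)] in force)
  then show ?thesis using V(1) by blast
qed

lemma delta_complete_imp_function_complete:
  assumes X: "tychonoff_space X" and d: "delta_complete X"
  shows "function_complete X"
  unfolding function_complete_def
proof (intro allI impI)
  fix F assume F: "filter_on (topspace X) F"
    "\<forall>\<P>. open_partition X \<P> \<longrightarrow> (\<exists>P\<in>\<P>. eventually (\<lambda>x. x \<in> P) F)"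
    "\<forall>g. continuous_map X euclideanreal g \<longrightarrow> (\<exists>l. (g \<longlongrightarrow> l) F)"
  have "\<exists>V\<in>\<V>. eventually (\<lambda>x. x \<in> V) F" if "\<V> \<in> star_finite_fine_uniformity X" for \<V>
  proof -
    obtain \<U> where U: "\<U> \<in> normal_covers X" "star_finite \<U>" "\<forall>U\<in>\<U>. openin X U" "cover_refines \<U> \<V>"
      using star_finite_fine_uniformityE[OF X \<open>\<V> \<in> _\<close>] by metis
    obtain U where "U \<in> \<U>" "eventually (\<lambda>x. x \<in> U) F"
      using eventually_in_member[OF U(1-3) F(1)] F(2,3) by blast
    moreover then obtain V where "V \<in> \<V>" "U \<subseteq> V" using U(4) unfolding cover_refines_def by metis
    ultimately show ?thesis by (meson eventually_mono subsetD)
  qed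
  then have "cauchy_filter (topspace X) (star_finite_fine_uniformity X) F"
    using F(1) by (simp add: cauchy_filter_def)
  then show "\<exists>x. limitin X id x F" using d unfolding delta_complete_iff[OF X] by blast
qed

section \<open>Closed embeddings and convergence\<close>

text \<open>A continuous injection into a Hausdorff space is a closed embedding if it reflects the convergence
  of filters. The next lemma gives the converse.\<close>

lemma closed_subspace_ofI:
  assumes Y: "Hausdorff_space Y" and e: "continuous_map X Y e" and inj: "inj_on e (topspace X)"
    and conv: "\<And>F y. filter_on (topspace X) F \<Longrightarrow> limitin Y e y F \<Longrightarrow> \<exists>x. limitin X id x F"
  shows "closed_subspace_of X Y"
proof -
  have "closed_map X Y e"
    unfolding closed_map_def
  proof (intro allI impI)
    fix C assume C: "closedin X C"
    have CX: "C \<subseteq> topspace X" using closedin_subset[OF C] .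
    have eY: "e ` topspace X \<subseteq> topspace Y" using continuous_map_image_subset_topspace[OF e] .
    have "Y closure_of (e ` C) \<subseteq> e ` C"
    proof
      fix y assume y: "y \<in> Y closure_of (e ` C)"
      then have yY: "y \<in> topspace Y" by (simp add: in_closure_of)
      \<comment> \<open>The trace on \<open>C\<close> of the preimage of the neighbourhood filter of \<open>y\<close>.\<close>
      define N where "N = {U. openin Y U \<and> y \<in> U}"
      define F where "F = (INF U\<in>N. principal {x \<in> C. e x \<in> U})"
      have N0: "topspace Y \<in> N" using yY by (simp add: N_def)
      have ev: "eventually P F \<longleftrightarrow> (\<exists>U\<in>N. \<forall>x\<in>C. e x \<in> U \<longrightarrow> P x)" for P
        unfolding F_def
      proof (subst eventually_INF_base)
        show "N \<noteq> {}" using N0 by blast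
        show "\<exists>W\<in>N. principal {x \<in> C. e x \<in> W} \<le> inf (principal {x \<in> C. e x \<in> U}) (principal {x \<in> C. e x \<in> V})"
          if "U \<in> N" "V \<in> N" for U V
          using that by (intro bexI[of _ "U \<inter> V"]) (auto simp: N_def)
      qed (auto simp: eventually_principal)
      have "F \<noteq> bot"
        unfolding trivial_limit_def ev
      proof
        assume "\<exists>U\<in>N. \<forall>x\<in>C. e x \<in> U \<longrightarrow> False"
        then obtain U where U: "openin Y U" "y \<in> U" "\<And>x. x \<in> C \<Longrightarrow> e x \<notin> U" by (auto simp: N_def)
        then have "\<exists>z\<in>e ` C. z \<in> U" using y unfolding in_closure_of by (elim conjE allE[of _ U]) auto
        then show False using U(3) by auto
      qed
      moreover have evC: "eventually (\<lambda>x. x \<in> C) F" unfolding ev using N0 by auto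
      moreover have "eventually (\<lambda>x. x \<in> topspace X) F"
        using evC by (rule eventually_mono) (use CX in auto)
      moreover have lim: "limitin Y e y F"
        unfolding limitin_def ev using yY by (auto simp: N_def)
      ultimately obtain x where x: "limitin X id x F"
        using conv[of F y] unfolding filter_on_def le_principal by auto
      have "x \<in> C"
        using limitin_closedin[OF x C] evC \<open>F \<noteq> bot\<close> by simp
      moreover have "limitin Y (e \<circ> id) (e x) F" by (rule continuous_map_limit[OF e x])
      then have "e x = y" using limitin_Hausdorff_unique[OF _ lim \<open>F \<noteq> bot\<close> Y] by simp
      ultimately show "y \<in> e ` C" by blast
    qed
    moreover have "e ` C \<subseteq> topspace Y" using CX eY by blast
    ultimately show "closedin Y (e ` C)" using closure_of_subset closure_of_eq by (metis subset_antisym)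
  qed
  then have "X homeomorphic_space subtopology Y (e ` topspace X)" "closedin Y (e ` topspace X)"
    using injective_closed_imp_embedding_map[OF e _ inj] embedding_map_imp_homeomorphic_space
    by (auto simp: closed_map_def)
  then show ?thesis unfolding closed_subspace_of_def by blast
qed

lemma closed_subspace_ofE:
  assumes "closed_subspace_of X Y"
  obtains e where "continuous_map X Y e" "inj_on e (topspace X)"
    "\<And>F y. filter_on (topspace X) F \<Longrightarrow> limitin Y e y F \<Longrightarrow> \<exists>x. limitin X id x F"
proof -
  obtain S where S: "closedin Y S" "X homeomorphic_space subtopology Y S"
    using assms unfolding closed_subspace_of_def by auto
  obtain e g where eg: "homeomorphic_maps X (subtopology Y S) e g"
    using S(2) unfolding homeomorphic_space_def by auto
  then have e: "continuous_map X (subtopology Y S) e" and g: "continuous_map (subtopology Y S) X g"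
    and ge: "\<And>x. x \<in> topspace X \<Longrightarrow> g (e x) = x"
    by (auto simp: homeomorphic_maps_def)
  have eS: "e x \<in> S" if "x \<in> topspace X" for x
    using continuous_map_image_subset_topspace[OF e] that by auto
  show ?thesis
  proof
    show "continuous_map X Y e" using e by (rule continuous_map_into_fulltopology)
    show "inj_on e (topspace X)" using ge by (metis inj_onI)
    fix F y assume F: "filter_on (topspace X) F" and lim: "limitin Y e y F"
    have F0: "F \<noteq> bot" and FX: "eventually (\<lambda>x. x \<in> topspace X) F"
      using F unfolding filter_on_def le_principal by auto
    have ev: "eventually (\<lambda>x. e x \<in> S) F" using FX by (rule eventually_mono) (rule eS)
    have "y \<in> S" using limitin_closedin[OF lim S(1) ev F0] .
    then have "limitin (subtopology Y S) e y F" using lim ev by (simp add: limitin_subtopology)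
    then have "limitin X (g \<circ> e) (g y) F" by (rule continuous_map_limit[OF g])
    moreover have "eventually (\<lambda>x. (g \<circ> e) x = id x) F"
      using FX by (rule eventually_mono) (simp add: ge)
    ultimately show "\<exists>x. limitin X id x F"
      using limitin_transform_eventually[of "g \<circ> e" id F X "g y"] by blast
  qed
qed

section \<open>Locally compact metric spaces\<close>

context Metric_space
begin

text \<open>The supremum of the radii, cut off at \<open>1\<close>, for which the closed ball around \<open>x\<close> is compact. The cut-off keeps
  the supremum finite. In a locally compact space it is positive and 1-Lipschitz.\<close>

definition compactness_radius :: "'a \<Rightarrow> real" where
  "compactness_radius x = Sup {s. 0 < s \<and> s \<le> 1 \<and> compactin mtopology (mcball x s)}"

text \<open>The distance relative to the compactness radius. The logarithm makes the
  quotient satisfy the triangle inequality; in a domain of Euclidean space, with the distance to the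
  boundary in place of the compactness radius, this is the distance ratio metric.\<close>

definition distance_ratio :: "'a \<Rightarrow> 'a \<Rightarrow> real" where
  "distance_ratio x y = ln (1 + d x y / min (compactness_radius x) (compactness_radius y))"

context
  assumes lc: "locally_compact_space mtopology"
begin

lemma compactness_radius_witness: "\<exists>s. 0 < s \<and> s \<le> 1 \<and> compactin mtopology (mcball x s)"
proof (cases "x \<in> M")
  case True
  then obtain U K where UK: "openin mtopology U" "compactin mtopology K" "x \<in> U" "U \<subseteq> K"
    using lc unfolding locally_compact_space_def by auto
  then obtain s where s: "s > 0" "mcball x s \<subseteq> U" unfolding openin_mtopology_mcball by auto
  have "mcball x (min s 1) \<subseteq> K" using s(2) UK(4) mcball_subset_concentric[of "min s 1" s x] by auto
  then have "compactin mtopology (mcball x (min s 1))" by (intro closed_compactin[OF UK(2)]) auto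
  then show ?thesis using s by (intro exI[of _ "min s 1"]) auto
next
  case False
  then show ?thesis by (intro exI[of _ 1]) (simp add: mcball_eq_empty[THEN iffD2])
qed

lemma
  shows compactness_radius_pos: "0 < compactness_radius x"
    and compactness_radius_le_1: "compactness_radius x \<le> 1"
    and compactness_radius_upper:
      "0 < s \<Longrightarrow> s \<le> 1 \<Longrightarrow> compactin mtopology (mcball x s) \<Longrightarrow> s \<le> compactness_radius x"
    and compactin_mcball_less: "t < compactness_radius x \<Longrightarrow> compactin mtopology (mcball x t)"
proof -
  let ?S = "{s. 0 < s \<and> s \<le> 1 \<and> compactin mtopology (mcball x s)}"
  have ne: "?S \<noteq> {}" using compactness_radius_witness by auto
  have bdd: "bdd_above ?S" by (auto simp: bdd_above_def)
  show upper: "s \<le> compactness_radius x" if "0 < s" "s \<le> 1" "compactin mtopology (mcball x s)" for s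
    unfolding compactness_radius_def by (rule cSup_upper[OF _ bdd]) (use that in simp)
  obtain s where "0 < s" "s \<le> 1" "compactin mtopology (mcball x s)"
    using compactness_radius_witness by blast
  then show "0 < compactness_radius x" using upper[of s] by simp
  show "compactness_radius x \<le> 1"
    unfolding compactness_radius_def by (rule cSup_least[OF ne]) auto
  show "compactin mtopology (mcball x t)" if t: "t < compactness_radius x" for t
  proof -
    obtain s where s: "compactin mtopology (mcball x s)" "t < s"
      using t unfolding compactness_radius_def less_cSup_iff[OF ne bdd] by auto
    then show ?thesis
      using closed_compactin[OF s(1) _ closedin_mcball] mcball_subset_concentric[of t s x] by simp
  qed
qed

lemma compactness_radius_Lipschitz:
  assumes "x \<in> M" "y \<in> M"
  shows "compactness_radius x \<le> compactness_radius y + d x y"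
  unfolding compactness_radius_def[of x]
proof (rule cSup_least)
  show "{s. 0 < s \<and> s \<le> 1 \<and> compactin mtopology (mcball x s)} \<noteq> {}"
    using compactness_radius_witness by auto
  fix s assume s: "s \<in> {s. 0 < s \<and> s \<le> 1 \<and> compactin mtopology (mcball x s)}"
  show "s \<le> compactness_radius y + d x y"
  proof (cases "s \<le> d x y")
    case True
    then show ?thesis using compactness_radius_pos[of y] by simp
  next
    case False
    have "mcball y (s - d x y) \<subseteq> mcball x s"
      using assms by (intro mcball_subset) (simp_all add: commute)
    then have "compactin mtopology (mcball y (s - d x y))"
      using s closed_compactin[of mtopology "mcball x s" "mcball y (s - d x y)"] by simp
    moreover have "s \<le> 1" using s by simp
    then have "s - d x y \<le> 1" using nonneg[of x y] by linarith
    ultimately show ?thesis using compactness_radius_upper[of "s - d x y" y] False by simp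
  qed
qed

lemma distance_ratio_less_iff:
  assumes "t > 0"
  shows "distance_ratio x y < ln (1 + t) \<longleftrightarrow>
    d x y < t * min (compactness_radius x) (compactness_radius y)"
proof -
  have m: "0 < min (compactness_radius x) (compactness_radius y)" using compactness_radius_pos by simp
  then have "0 \<le> d x y / min (compactness_radius x) (compactness_radius y)" by simp
  then have "distance_ratio x y < ln (1 + t) \<longleftrightarrow>
      d x y / min (compactness_radius x) (compactness_radius y) < t"
    unfolding distance_ratio_def using assms by (subst ln_less_cancel_iff) auto
  then show ?thesis using m by (simp add: pos_divide_less_eq)
qed

lemma Metric_space_distance_ratio: "Metric_space M distance_ratio"
proof
  note pos = compactness_radius_pos
  have quot: "0 \<le> d x y / min (compactness_radius x) (compactness_radius y)" for x y
    using pos[of x] pos[of y] by (intro divide_nonneg_nonneg) auto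
  show "0 \<le> distance_ratio x y" for x y
    unfolding distance_ratio_def using quot[of x y] by simp
  show "distance_ratio x y = distance_ratio y x" for x y
    by (simp add: distance_ratio_def commute min.commute)
  show "(distance_ratio x y = 0) = (x = y)" if "x \<in> M" "y \<in> M" for x y
  proof -
    have "distance_ratio x y = 0 \<longleftrightarrow> d x y / min (compactness_radius x) (compactness_radius y) = 0"
      unfolding distance_ratio_def using quot[of x y] by (subst ln_eq_zero_iff) auto
    also have "\<dots> \<longleftrightarrow> d x y = 0" using pos[of x] pos[of y] by (auto simp: min_def)
    finally show ?thesis using that by simp
  qed
  show "distance_ratio x z \<le> distance_ratio x y + distance_ratio y z"
    if M: "x \<in> M" "y \<in> M" "z \<in> M" for x y z
  proof -
    define q where "q x y = 1 + d x y / min (compactness_radius x) (compactness_radius y)" for x y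
    have q1: "1 \<le> q x y" for x y using quot[of x y] by (simp add: q_def)
    \<comment> \<open>The triangle inequality in multiplicative form; it needs \<open>r y \<le> r x + d x y\<close>.\<close>
    have key: "1 + d x z / compactness_radius x \<le> q x y * q y z" if M: "x \<in> M" "y \<in> M" "z \<in> M" for x y z
    proof -
      let ?a = "compactness_radius x" and ?b = "compactness_radius y"
      have "1 + d x y / ?a \<le> q x y" "1 + d y z / ?b \<le> q y z"
        unfolding q_def using pos[of x] pos[of y] pos[of z]
        by (auto intro!: divide_left_mono mult_pos_pos)
      then have "(1 + d x y / ?a) * (1 + d y z / ?b) \<le> q x y * q y z"
        using pos[of x] pos[of y] q1[of x y] by (intro mult_mono) auto
      moreover have "?b / ?a \<le> 1 + d x y / ?a"
        using compactness_radius_Lipschitz[OF M(2,1)] pos[of x] by (simp add: field_simps commute)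
      then have "?b / ?a * (d y z / ?b) \<le> (1 + d x y / ?a) * (d y z / ?b)"
        using pos[of y] by (intro mult_right_mono) auto
      moreover have "?b / ?a * (d y z / ?b) = d y z / ?a" using pos[of y] by simp
      moreover have "d x z / ?a \<le> (d x y + d y z) / ?a"
        using triangle[OF M] pos[of x] by (intro divide_right_mono) auto
      moreover have "(1 + d x y / ?a) * (1 + d y z / ?b) = 1 + d x y / ?a + (1 + d x y / ?a) * (d y z / ?b)"
        by (simp only: distrib_left mult_1_right)
      ultimately show ?thesis unfolding add_divide_distrib by linarith
    qed
    have "q x z \<le> q x y * q y z"
    proof (cases "compactness_radius x \<le> compactness_radius z")
      case True
      then show ?thesis using key[OF M] by (simp add: q_def)
    next
      case False
      then have "q x z = 1 + d z x / compactness_radius z" by (simp add: q_def commute)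
      also have "\<dots> \<le> q z y * q y x" using key[OF M(3,2,1)] .
      also have "\<dots> = q x y * q y z" by (simp add: q_def commute min.commute mult.commute)
      finally show ?thesis .
    qed
    then have "ln (q x z) \<le> ln (q x y * q y z)"
      using q1[of x z] q1[of x y] q1[of y z] by (subst ln_le_cancel_iff) (auto intro: mult_pos_pos)
    also have "\<dots> = ln (q x y) + ln (q y z)" using q1[of x y] q1[of y z] by (intro ln_mult_pos) auto
    finally show ?thesis by (simp add: q_def distance_ratio_def)
  qed
qed

lemma mtopology_distance_ratio: "Metric_space.mtopology M distance_ratio = mtopology"
proof -
  interpret R: Metric_space M distance_ratio by (rule Metric_space_distance_ratio)
  have 1: "\<exists>s>0. R.mball x s \<subseteq> mball x \<epsilon>" if "\<epsilon> > 0" for x \<epsilon>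
  proof (intro exI conjI)
    show "0 < ln (1 + \<epsilon>)" using that by simp
    have "d x y < \<epsilon>" if "distance_ratio x y < ln (1 + \<epsilon>)" for y
    proof -
      have "d x y < \<epsilon> * min (compactness_radius x) (compactness_radius y)"
        using that distance_ratio_less_iff[OF \<open>\<epsilon> > 0\<close>] by simp
      also have "\<dots> \<le> \<epsilon> * 1"
        using \<open>\<epsilon> > 0\<close> compactness_radius_le_1[of x] by (intro mult_left_mono) auto
      finally show ?thesis by simp
    qed
    then show "R.mball x (ln (1 + \<epsilon>)) \<subseteq> mball x \<epsilon>" by auto
  qed
  have 2: "\<exists>s>0. mball x s \<subseteq> R.mball x \<epsilon>" if "\<epsilon> > 0" "x \<in> M" for x \<epsilon>
  proof (intro exI conjI)
    let ?r = "compactness_radius x"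
    let ?t = "exp \<epsilon> - 1"
    let ?s = "min (?r/2) (?t * (?r/2))"
    have r: "0 < ?r" and t: "0 < ?t" using compactness_radius_pos that by auto
    show "0 < ?s" using r t by simp
    have "distance_ratio x y < \<epsilon>" if "y \<in> M" "d x y < ?s" for y
    proof -
      have "?r / 2 \<le> min ?r (compactness_radius y)"
        using compactness_radius_Lipschitz[OF \<open>x \<in> M\<close> \<open>y \<in> M\<close>] that r by simp
      then have "?t * (?r / 2) \<le> ?t * min ?r (compactness_radius y)"
        using t by (intro mult_left_mono) auto
      then have "d x y < ?t * min ?r (compactness_radius y)" using that by simp
      then show ?thesis using distance_ratio_less_iff[OF t] by simp
    qed
    then show "mball x ?s \<subseteq> R.mball x \<epsilon>" using \<open>x \<in> M\<close> by auto
  qed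
  have "openin R.mtopology U \<longleftrightarrow> openin mtopology U" for U
  proof
    assume U: "openin R.mtopology U"
    show "openin mtopology U"
      unfolding openin_mtopology
    proof (intro conjI allI impI)
      show "U \<subseteq> M" using U R.openin_mtopology by simp
      fix x assume "x \<in> U"
      then obtain \<epsilon> where "\<epsilon> > 0" "R.mball x \<epsilon> \<subseteq> U" using U R.openin_mtopology by auto
      moreover have "x \<in> M" using \<open>x \<in> U\<close> U R.openin_mtopology by auto
      ultimately show "\<exists>r>0. mball x r \<subseteq> U" using 2[of \<epsilon> x] by (meson subset_trans)
    qed
  next
    assume U: "openin mtopology U"
    show "openin R.mtopology U"
      unfolding R.openin_mtopology
    proof (intro conjI allI impI)
      show "U \<subseteq> M" using U openin_mtopology by simp
      fix x assume "x \<in> U"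
      then obtain \<epsilon> where "\<epsilon> > 0" "mball x \<epsilon> \<subseteq> U" using U openin_mtopology by auto
      then show "\<exists>r>0. R.mball x r \<subseteq> U" using 1[of \<epsilon> x] by (meson subset_trans)
    qed
  qed
  then show ?thesis by (simp add: topology_eq)
qed

text \<open>For \<open>x\<close> in \<open>mball k (r k / 8)\<close> and \<open>d x y < r x / 4\<close>, the Lipschitz condition gives
  \<open>d k y \<le> r k / 2\<close>, and \<open>mcball k (r k / 2)\<close> is compact.\<close>

lemma compact_neighbourhood_distance_ratio:
  assumes K: "compactin mtopology K"
  obtains K' where "compactin mtopology K'"
    "\<And>x y. \<lbrakk>x \<in> K; y \<in> M; distance_ratio x y < ln (1 + 1/4)\<rbrakk> \<Longrightarrow> y \<in> K'"
proof -
  let ?r = compactness_radius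
  have KM: "K \<subseteq> M" using compactin_subset_topspace[OF K] by simp
  have "K \<subseteq> \<Union>((\<lambda>k. mball k (?r k / 8)) ` K)"
    using KM compactness_radius_pos by auto
  then obtain \<F> where F: "finite \<F>" "\<F> \<subseteq> (\<lambda>k. mball k (?r k / 8)) ` K" "K \<subseteq> \<Union>\<F>"
    using compactinD[OF K, of "(\<lambda>k. mball k (?r k / 8)) ` K"] by auto
  then obtain T where T: "finite T" "T \<subseteq> K" "\<F> = (\<lambda>k. mball k (?r k / 8)) ` T"
    by (meson finite_subset_image)
  show ?thesis
  proof
    show "compactin mtopology (\<Union>((\<lambda>k. mcball k (?r k / 2)) ` T))"
      using T(1) compactness_radius_pos by (intro compactin_Union) (auto intro!: compactin_mcball_less)
    fix x y assume xy: "x \<in> K" "y \<in> M" "distance_ratio x y < ln (1 + 1/4)"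
    have "d x y < 1/4 * min (?r x) (?r y)"
      using xy(3) distance_ratio_less_iff[of "1/4"] by simp
    then have dxy: "d x y < ?r x / 4" by simp
    obtain k where k: "k \<in> T" "x \<in> mball k (?r k / 8)" using F(3) T(3) xy(1) by auto
    then have "k \<in> M" "x \<in> M" "d k x < ?r k / 8" by auto
    then have "?r x \<le> ?r k + ?r k / 8" "d k y \<le> d k x + d x y"
      using compactness_radius_Lipschitz[of x k] commute[of x k] triangle[of k x y] xy(2) by auto
    then have "d k y \<le> ?r k / 2" using dxy \<open>d k x < ?r k / 8\<close> compactness_radius_pos[of k] by linarith
    then show "y \<in> \<Union>((\<lambda>k. mcball k (?r k / 2)) ` T)" using k(1) \<open>k \<in> M\<close> xy(2) by auto
  qed
qed

end
end

text \<open>For one fixed \<open>\<epsilon>\<close>, the \<open>\<epsilon>\<close>-neighbourhood of every compact set lies in a compact set.\<close>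

definition uniformly_locally_compact_metric :: "'a metric \<Rightarrow> bool" where
  "uniformly_locally_compact_metric m \<longleftrightarrow>
     (\<exists>\<epsilon>>0. \<forall>K. compactin (mtopology_of m) K \<longrightarrow>
       (\<exists>K'. compactin (mtopology_of m) K' \<and> (\<forall>x\<in>K. \<forall>y\<in>mspace m. mdist m x y < \<epsilon> \<longrightarrow> y \<in> K')))"

lemma locally_compact_imp_uniformly_locally_compact_metric:
  assumes "locally_compact_space (mtopology_of m)"
  obtains m' where "mtopology_of m' = mtopology_of m" "uniformly_locally_compact_metric m'"
proof -
  interpret m: Metric_space "mspace m" "mdist m" by simp
  have top: "m.mtopology = mtopology_of m" by (simp add: mtopology_of_def)
  have lc: "locally_compact_space m.mtopology" using assms top by simp
  interpret R: Metric_space "mspace m" m.distance_ratio by (rule m.Metric_space_distance_ratio[OF lc])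
  let ?m = "metric (mspace m, m.distance_ratio)"
  have t: "mtopology_of ?m = mtopology_of m"
    using m.mtopology_distance_ratio[OF lc] top by simp
  moreover have "uniformly_locally_compact_metric ?m"
    unfolding uniformly_locally_compact_metric_def t R.mdist_metric R.mspace_metric
  proof (intro exI[of _ "ln (1 + 1/4)"] conjI allI impI)
    fix K assume "compactin (mtopology_of m) K"
    then show "\<exists>K'. compactin (mtopology_of m) K' \<and>
      (\<forall>x\<in>K. \<forall>y\<in>mspace m. m.distance_ratio x y < ln (1 + 1/4) \<longrightarrow> y \<in> K')"
      using m.compact_neighbourhood_distance_ratio[OF lc, of K] unfolding top by metis
  qed simp
  ultimately show ?thesis using that by blast
qed

section \<open>Ultrafilters\<close>

text \<open>By Zorn, below every proper filter there is a minimal proper filter.\<close>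

lemma ultrafilter_below:
  fixes F :: "'a filter"
  assumes "F \<noteq> bot"
  obtains G where "G \<noteq> bot" "G \<le> F" "\<And>P. eventually P G \<or> eventually (\<lambda>x. \<not> P x) G"
proof -
  define A where "A = {G. G \<noteq> bot \<and> G \<le> F}"
  have "\<exists>G\<in>A. \<forall>H\<in>A. H \<le> G \<longrightarrow> H = G"
  proof (rule predicate_Zorn[where P="\<lambda>G H. H \<le> G"])
    show "partial_order_on A (relation_of (\<lambda>G H. H \<le> G) A)"
      by (rule partial_order_on_relation_ofI) auto
    fix C assume C: "C \<in> Chains (relation_of (\<lambda>G H. H \<le> G) A)"
    show "\<exists>u\<in>A. \<forall>a\<in>C. u \<le> a"
    proof (cases "C = {}")
      case True
      then show ?thesis using assms by (auto simp: A_def)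
    next
      case False
      have CA: "C \<subseteq> A" using C unfolding Chains_def relation_of_def by blast
      have base: "\<exists>x\<in>C. x \<le> inf G H" if "G \<in> C" "H \<in> C" for G H
      proof -
        have "H \<le> G \<or> G \<le> H" using C that unfolding Chains_def relation_of_def by blast
        then show ?thesis using that by (metis inf.order_iff inf.commute order_refl)
      qed
      have "Inf C \<noteq> bot"
      proof
        assume "Inf C = bot"
        then have "eventually (\<lambda>x. False) (Inf C)" by simp
        then obtain G where "G \<in> C" "eventually (\<lambda>x. False) G"
          using eventually_Inf_base[OF False base] by auto
        then show False using CA by (auto simp: A_def trivial_limit_def)
      qed
      moreover obtain G where "G \<in> C" using False by blast
      then have "Inf C \<le> F" using CA Inf_lower[of G C] unfolding A_def by (auto intro: order_trans)
      ultimately show ?thesis using Inf_lower[of _ C] by (intro bexI[of _ "Inf C"]) (auto simp: A_def)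
    qed
  qed
  then obtain G where G: "G \<in> A" and min: "\<And>H. H \<in> A \<Longrightarrow> H \<le> G \<Longrightarrow> H = G" by blast
  have "eventually P G \<or> eventually (\<lambda>x. \<not> P x) G" for P
  proof (rule disjCI)
    assume n: "\<not> eventually (\<lambda>x. \<not> P x) G"
    let ?H = "inf G (principal {x. P x})"
    have "?H \<noteq> bot"
      using n by (simp add: trivial_limit_def eventually_inf_principal)
    then have "?H = G" using G by (intro min) (auto simp: A_def intro: le_infI1)
    then have "G \<le> principal {x. P x}" by (metis inf.cobounded2)
    then show "eventually P G" by (simp add: le_principal)
  qed
  moreover have "G \<noteq> bot" "G \<le> F" using G by (simp_all add: A_def)
  ultimately show ?thesis using that by metis
qed

lemma ultrafilter_limit_in_compact:
  assumes K: "compactin X K" and ev: "eventually (\<lambda>x. f x \<in> K) G" and G: "G \<noteq> bot"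
    and ultra: "\<And>P. eventually P G \<or> eventually (\<lambda>x. \<not> P x) G"
  obtains y where "limitin X f y G"
proof (rule ccontr)
  assume "\<not> thesis"
  then have no: "\<not> limitin X f y G" for y using that by blast
  have KX: "K \<subseteq> topspace X" using compactin_subset_topspace[OF K] .
  have "\<exists>U. openin X U \<and> y \<in> U \<and> eventually (\<lambda>x. f x \<notin> U) G" if y: "y \<in> K" for y
  proof -
    obtain U where U: "openin X U" "y \<in> U" "\<not> eventually (\<lambda>x. f x \<in> U) G"
      using no[of y] subsetD[OF KX y] unfolding limitin_def by auto
    then show ?thesis using ultra[of "\<lambda>x. f x \<in> U"] by auto
  qed
  then obtain U where U: "\<And>y. y \<in> K \<Longrightarrow> openin X (U y) \<and> y \<in> U y \<and> eventually (\<lambda>x. f x \<notin> U y) G"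
    by metis
  have "\<exists>\<F>. finite \<F> \<and> \<F> \<subseteq> U ` K \<and> K \<subseteq> \<Union>\<F>"
    using compactinD[OF K, of "U ` K"] U by blast
  then obtain \<F> where F: "finite \<F>" "\<F> \<subseteq> U ` K" "K \<subseteq> \<Union>\<F>" by blast
  have "eventually (\<lambda>x. f x \<notin> V) G" if "V \<in> \<F>" for V using F(2) U that by auto
  then have "eventually (\<lambda>x. \<forall>V\<in>\<F>. f x \<notin> V) G" using F(1) by (simp add: eventually_ball_finite)
  with ev have "eventually (\<lambda>x. False) G" by eventually_elim (use F(3) in auto)
  then show False using G by (simp add: trivial_limit_def)
qed

section \<open>The uniformity of a family of metric coordinates\<close>

text \<open>A family of continuous maps \<open>x \<mapsto> e x i\<close> from \<open>X\<close> to metric spaces \<open>M i\<close> that separates points and reflects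
  convergence of filters, which is what a closed embedding into the product of the \<open>M i\<close> amounts to. Working
  with the coordinates avoids the extensional functions of the product topology.\<close>

locale metric_coordinates =
  fixes X :: "'a topology" and I :: "'i set" and M :: "'i \<Rightarrow> 'm metric" and e :: "'a \<Rightarrow> 'i \<Rightarrow> 'm"
  assumes cont: "i \<in> I \<Longrightarrow> continuous_map X (mtopology_of (M i)) (\<lambda>x. e x i)"
    and sep: "x \<in> topspace X \<Longrightarrow> y \<in> topspace X \<Longrightarrow> (\<And>i. i \<in> I \<Longrightarrow> e x i = e y i) \<Longrightarrow> x = y"
    and conv: "filter_on (topspace X) F \<Longrightarrow>
      (\<And>i. i \<in> I \<Longrightarrow> \<exists>l. limitin (mtopology_of (M i)) (\<lambda>x. e x i) l F) \<Longrightarrow> \<exists>x. limitin X id x F"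
begin

text \<open>The points whose coordinates in \<open>J\<close> are \<open>\<epsilon>\<close>-close to those of \<open>x\<close>; for finite \<open>J\<close> these are basic entourage balls.\<close>

definition near :: "'i set \<Rightarrow> real \<Rightarrow> 'a \<Rightarrow> 'a set" where
  "near J \<epsilon> x = {y \<in> topspace X. \<forall>i\<in>J. mdist (M i) (e x i) (e y i) < \<epsilon>}"

text \<open>The cover by all \<open>\<epsilon>\<close>-balls for the coordinates in \<open>J\<close>.\<close>

definition near_cover :: "'i set \<Rightarrow> real \<Rightarrow> 'a set set" where
  "near_cover J \<epsilon> = near J \<epsilon> ` topspace X"

text \<open>The coarsest uniformity that makes all coordinates uniformly continuous.\<close>

definition coordinate_uniformity :: "'a set set set" where
  "coordinate_uniformity = {\<V>. \<Union>\<V> = topspace X \<and>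
     (\<exists>J \<epsilon>. finite J \<and> J \<subseteq> I \<and> \<epsilon> > 0 \<and> cover_refines (near_cover J \<epsilon>) \<V>)}"

lemma mem: "x \<in> topspace X \<Longrightarrow> i \<in> I \<Longrightarrow> e x i \<in> mspace (M i)"
  using continuous_map_image_subset_topspace[OF cont] by fastforce

lemma near_refl: "x \<in> topspace X \<Longrightarrow> J \<subseteq> I \<Longrightarrow> \<epsilon> > 0 \<Longrightarrow> x \<in> near J \<epsilon> x"
  unfolding near_def
proof (intro CollectI conjI ballI)
  fix i assume "x \<in> topspace X" "J \<subseteq> I" "\<epsilon> > 0" "i \<in> J"
  then show "mdist (M i) (e x i) (e x i) < \<epsilon>"
    using mdist_zero[OF mem mem, of x i x] by auto
qed

lemma near_mono: "J \<subseteq> J' \<Longrightarrow> \<epsilon>' \<le> \<epsilon> \<Longrightarrow> near J' \<epsilon>' x \<subseteq> near J \<epsilon> x"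
  by (force simp: near_def)

lemma Union_near_cover: "J \<subseteq> I \<Longrightarrow> \<epsilon> > 0 \<Longrightarrow> \<Union>(near_cover J \<epsilon>) = topspace X"
  using near_refl by (auto simp: near_cover_def near_def)

lemma near_cover_uniform:
  "finite J \<Longrightarrow> J \<subseteq> I \<Longrightarrow> \<epsilon> > 0 \<Longrightarrow> near_cover J \<epsilon> \<in> coordinate_uniformity"
  unfolding coordinate_uniformity_def using Union_near_cover
  by (auto intro!: exI[of _ J] exI[of _ \<epsilon>] simp: cover_refines_def)

lemma near_cover_mono:
  assumes "J \<subseteq> J'" "\<epsilon>' \<le> \<epsilon>"
  shows "cover_refines (near_cover J' \<epsilon>') (near_cover J \<epsilon>)"
  using near_mono[OF assms] by (auto simp: cover_refines_def near_cover_def)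

lemma openin_near:
  assumes "finite J" "J \<subseteq> I" "x \<in> topspace X"
  shows "openin X (near J \<epsilon> x)"
proof -
  have "near J \<epsilon> x = topspace X \<inter> (\<Inter>i\<in>J. {y \<in> topspace X. e y i \<in> mball_of (M i) (e x i) \<epsilon>})"
    using mem assms by (auto simp: near_def subset_iff)
  moreover have "openin X {y \<in> topspace X. e y i \<in> mball_of (M i) (e x i) \<epsilon>}" if "i \<in> J" for i
  proof (rule openin_continuous_map_preimage[OF cont])
    show "openin (mtopology_of (M i)) (mball_of (M i) (e x i) \<epsilon>)"
      unfolding mtopology_of_def mball_of_def
      by (rule Metric_space.openin_mball) simp
  qed (use assms that in auto)
  ultimately show ?thesis
    using assms(1) by (cases "J = {}") (auto intro!: openin_Int openin_INT)
qed

lemma near_third: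
  assumes "x \<in> topspace X" "J \<subseteq> I"
  shows "star (near J (\<epsilon>/3) x) (near_cover J (\<epsilon>/3)) \<subseteq> near J \<epsilon> x"
proof
  fix y assume "y \<in> star (near J (\<epsilon>/3) x) (near_cover J (\<epsilon>/3))"
  then obtain z w where *: "z \<in> topspace X" "y \<in> near J (\<epsilon>/3) z" "w \<in> near J (\<epsilon>/3) z" "w \<in> near J (\<epsilon>/3) x"
    by (auto simp: star_def near_cover_def)
  have "mdist (M i) (e x i) (e y i) < \<epsilon>" if i: "i \<in> J" for i
  proof -
    have m: "e x i \<in> mspace (M i)" "e y i \<in> mspace (M i)" "e z i \<in> mspace (M i)" "e w i \<in> mspace (M i)"
      using mem * assms i by (auto simp: near_def)
    have "mdist (M i) (e x i) (e y i) \<le> mdist (M i) (e x i) (e w i) + mdist (M i) (e w i) (e y i)"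
      "mdist (M i) (e w i) (e y i) \<le> mdist (M i) (e w i) (e z i) + mdist (M i) (e z i) (e y i)"
      using m by (auto intro: mdist_triangle)
    moreover have "mdist (M i) (e x i) (e w i) < \<epsilon>/3" "mdist (M i) (e z i) (e w i) < \<epsilon>/3"
      "mdist (M i) (e z i) (e y i) < \<epsilon>/3"
      using * i by (auto simp: near_def)
    ultimately show ?thesis using mdist_commute[of "M i" "e w i" "e z i"] by linarith
  qed
  then show "y \<in> near J \<epsilon> x" using *(2) by (simp add: near_def)
qed

lemma star_refines_near_cover:
  assumes "J \<subseteq> I"
  shows "star_refines (near_cover J (\<epsilon>/3)) (near_cover J \<epsilon>)"
  unfolding star_refines_def
proof
  fix U assume "U \<in> near_cover J (\<epsilon>/3)"
  then obtain x where "x \<in> topspace X" "U = near J (\<epsilon>/3) x" by (auto simp: near_cover_def)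
  then show "\<exists>V\<in>near_cover J \<epsilon>. star U (near_cover J (\<epsilon>/3)) \<subseteq> V"
    using near_third[OF _ assms] by (auto simp: near_cover_def)
qed

lemma hausdorff_coordinate_uniformity: "hausdorff_uniformity (topspace X) coordinate_uniformity"
  unfolding hausdorff_uniformity_def
proof (intro conjI ballI allI impI)
  have "near_cover {} 1 \<in> coordinate_uniformity" by (rule near_cover_uniform) auto
  then show "coordinate_uniformity \<noteq> {}" by (rule ex_in_conv[THEN iffD1, OF exI])
  show "\<Union>\<U> = topspace X" if "\<U> \<in> coordinate_uniformity" for \<U>
    using that unfolding coordinate_uniformity_def by (elim CollectE conjE)
  show "\<V> \<in> coordinate_uniformity"
    if U: "\<U> \<in> coordinate_uniformity" and V: "\<Union>\<V> = topspace X \<and> cover_refines \<U> \<V>" for \<U> \<V>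
  proof -
    obtain J \<epsilon> where J: "finite J" "J \<subseteq> I" "\<epsilon> > 0" "cover_refines (near_cover J \<epsilon>) \<U>"
      using U unfolding coordinate_uniformity_def by auto
    have "cover_refines (near_cover J \<epsilon>) \<V>"
      using J(4) V unfolding cover_refines_def by (meson subset_trans)
    then show ?thesis using J V unfolding coordinate_uniformity_def by auto
  qed
  show "\<exists>\<W>\<in>coordinate_uniformity. star_refines \<W> \<U> \<and> star_refines \<W> \<V>"
    if U: "\<U> \<in> coordinate_uniformity" and V: "\<V> \<in> coordinate_uniformity" for \<U> \<V>
  proof -
    obtain J \<epsilon> where J: "finite J" "J \<subseteq> I" "\<epsilon> > 0" "cover_refines (near_cover J \<epsilon>) \<U>"
      using U unfolding coordinate_uniformity_def by auto
    obtain K \<eta> where K: "finite K" "K \<subseteq> I" "\<eta> > 0" "cover_refines (near_cover K \<eta>) \<V>"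
      using V unfolding coordinate_uniformity_def by auto
    let ?N = "near_cover (J \<union> K) (min \<epsilon> \<eta>)" and ?W = "near_cover (J \<union> K) (min \<epsilon> \<eta> / 3)"
    have "star_refines ?W ?N" using J K by (intro star_refines_near_cover) auto
    moreover have "cover_refines ?N (near_cover J \<epsilon>)" "cover_refines ?N (near_cover K \<eta>)"
      by (intro near_cover_mono; simp)+
    ultimately have "star_refines ?W \<U>" "star_refines ?W \<V>"
      using J(4) K(4) unfolding star_refines_def cover_refines_def by (meson subset_trans)+
    moreover have "?W \<in> coordinate_uniformity" using J K by (intro near_cover_uniform) auto
    ultimately show ?thesis by blast
  qed
  show "\<exists>\<U>\<in>coordinate_uniformity. y \<notin> star {x} \<U>"
    if xy: "x \<in> topspace X" "y \<in> topspace X" "x \<noteq> y" for x y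
  proof -
    obtain i where i: "i \<in> I" "e x i \<noteq> e y i" using sep xy by blast
    let ?d = "mdist (M i) (e x i) (e y i)"
    have d: "?d > 0" using i xy mem mdist_nonneg[of "M i" "e x i" "e y i"] by (simp add: less_le)
    have "y \<notin> star {x} (near_cover {i} (?d / 2))"
    proof
      assume "y \<in> star {x} (near_cover {i} (?d / 2))"
      then obtain z where z: "z \<in> topspace X" "mdist (M i) (e z i) (e x i) < ?d / 2"
        "mdist (M i) (e z i) (e y i) < ?d / 2"
        by (auto simp: star_def near_cover_def near_def)
      have "?d \<le> mdist (M i) (e x i) (e z i) + mdist (M i) (e z i) (e y i)"
        using mem xy z i by (intro mdist_triangle) auto
      then show False using z(2,3) mdist_commute[of "M i" "e x i" "e z i"] by linarith
    qed
    moreover have "near_cover {i} (?d / 2) \<in> coordinate_uniformity"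
      using i d by (intro near_cover_uniform) auto
    ultimately show ?thesis by blast
  qed
qed

text \<open>The balls form neighbourhood bases: otherwise the traces of the balls around \<open>x\<close> on the complement of \<open>S\<close>
  generate a filter that converges to \<open>x\<close> in every coordinate, hence converges, necessarily to \<open>x\<close>.\<close>

lemma near_subset_open:
  assumes S: "openin X S" and x: "x \<in> S"
  shows "\<exists>J \<epsilon>. finite J \<and> J \<subseteq> I \<and> \<epsilon> > 0 \<and> near J \<epsilon> x \<subseteq> S"
proof (rule ccontr)
  assume no: "\<not> ?thesis"
  have xX: "x \<in> topspace X" using openin_subset[OF S] x by blast
  define N where "N = {J. finite J \<and> J \<subseteq> I} \<times> {0::real<..}"
  define F where "F = (INF p\<in>N. principal (near (fst p) (snd p) x - S))"
  have ev: "eventually P F \<longleftrightarrow> (\<exists>J \<epsilon>. finite J \<and> J \<subseteq> I \<and> \<epsilon> > 0 \<and> (\<forall>y\<in>near J \<epsilon> x - S. P y))" for P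
    unfolding F_def
  proof (subst eventually_INF_base)
    show "N \<noteq> {}" unfolding N_def by (auto intro!: exI[of _ "{}"] exI[of _ 1])
    show "\<exists>r\<in>N. principal (near (fst r) (snd r) x - S)
        \<le> inf (principal (near (fst p) (snd p) x - S)) (principal (near (fst q) (snd q) x - S))"
      if "p \<in> N" "q \<in> N" for p q
    proof (intro bexI)
      show "(fst p \<union> fst q, min (snd p) (snd q)) \<in> N" using that by (auto simp: N_def)
    qed (use near_mono in \<open>auto simp: near_def\<close>)
  qed (auto simp: eventually_principal N_def)
  have "F \<noteq> bot" unfolding trivial_limit_def ev using no by blast
  moreover have FX: "eventually (\<lambda>y. y \<in> topspace X) F"
    unfolding ev by (intro exI[of _ "{}"] exI[of _ 1]) (auto simp: near_def)
  ultimately have F: "filter_on (topspace X) F"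
    unfolding filter_on_def le_principal by simp
  have lim: "limitin (mtopology_of (M i)) (\<lambda>y. e y i) (e x i) F" if i: "i \<in> I" for i
    unfolding mtopology_of_def Metric_space.limitin_metric[OF Metric_space_mspace_mdist]
  proof (intro conjI allI impI)
    show "e x i \<in> mspace (M i)" using mem[OF xX i] .
    fix \<epsilon> :: real assume "\<epsilon> > 0"
    then show "\<forall>\<^sub>F y in F. e y i \<in> mspace (M i) \<and> mdist (M i) (e y i) (e x i) < \<epsilon>"
      unfolding ev using i mem by (intro exI[of _ "{i}"] exI[of _ \<epsilon>]) (auto simp: near_def mdist_commute)
  qed
  then obtain z where z: "limitin X id z F" using conv[OF F] by blast
  have "z = x"
  proof (rule sep)
    show "z \<in> topspace X" using limitin_topspace[OF z] .
    fix i assume i: "i \<in> I"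
    have "limitin (mtopology_of (M i)) (\<lambda>y. e y i) (e z i) F"
      using continuous_map_limit[OF cont[OF i] z] by (simp add: o_def)
    moreover have "Hausdorff_space (mtopology_of (M i))"
      unfolding mtopology_of_def by (simp add: Metric_space.Hausdorff_space_mtopology)
    ultimately show "e z i = e x i"
      using limitin_Hausdorff_unique lim[OF i] \<open>F \<noteq> bot\<close> by metis
  qed fact
  then have "eventually (\<lambda>y. y \<in> S) F" using z S x unfolding limitin_def by simp
  moreover have "eventually (\<lambda>y. y \<notin> S) F"
    unfolding ev by (intro exI[of _ "{}"] exI[of _ 1]) auto
  ultimately have "eventually (\<lambda>y. False) F" by eventually_elim simp
  then show False using \<open>F \<noteq> bot\<close> by (simp add: trivial_limit_def)
qed

lemma uniformizable_by_coordinate_uniformity: "uniformizable_by X coordinate_uniformity"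
proof -
  note H = hausdorff_coordinate_uniformity
  have "openin (uniform_topology (topspace X) coordinate_uniformity) S \<longleftrightarrow> openin X S" for S
    unfolding openin_uniform_topology[OF H]
  proof
    assume S: "openin X S"
    have "\<exists>\<U>\<in>coordinate_uniformity. star {x} \<U> \<subseteq> S" if x: "x \<in> S" for x
    proof -
      obtain J \<epsilon> where J: "finite J" "J \<subseteq> I" "\<epsilon> > 0" "near J \<epsilon> x \<subseteq> S"
        using near_subset_open[OF S x] by metis
      have xX: "x \<in> topspace X" using openin_subset[OF S] x by blast
      have "{x} \<subseteq> near J (\<epsilon>/3) x" using near_refl[OF xX J(2)] J(3) by simp
      then have "star {x} (near_cover J (\<epsilon>/3)) \<subseteq> star (near J (\<epsilon>/3) x) (near_cover J (\<epsilon>/3))"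
        unfolding star_def by blast
      also have "\<dots> \<subseteq> S" using near_third[OF xX J(2)] J(4) by (rule subset_trans)
      finally show ?thesis using near_cover_uniform[OF J(1,2), of "\<epsilon>/3"] J(3) by auto
    qed
    then show "S \<subseteq> topspace X \<and> (\<forall>x\<in>S. \<exists>\<U>\<in>coordinate_uniformity. star {x} \<U> \<subseteq> S)"
      using openin_subset[OF S] by blast
  next
    assume S: "S \<subseteq> topspace X \<and> (\<forall>x\<in>S. \<exists>\<U>\<in>coordinate_uniformity. star {x} \<U> \<subseteq> S)"
    show "openin X S"
    proof (subst openin_subopen, rule ballI)
      fix x assume x: "x \<in> S"
      then obtain \<U> where U: "\<U> \<in> coordinate_uniformity" "star {x} \<U> \<subseteq> S" using S by blast
      obtain J \<epsilon> where J: "finite J" "J \<subseteq> I" "\<epsilon> > 0" "cover_refines (near_cover J \<epsilon>) \<U>"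
        using U(1) unfolding coordinate_uniformity_def by auto
      have xX: "x \<in> topspace X" using S x by blast
      then obtain V where V: "V \<in> \<U>" "near J \<epsilon> x \<subseteq> V"
        using J(4) unfolding cover_refines_def near_cover_def by auto
      have xn: "x \<in> near J \<epsilon> x" using near_refl[OF xX J(2,3)] .
      then have "V \<subseteq> star {x} \<U>" using V by (auto simp: star_def)
      then show "\<exists>T. openin X T \<and> x \<in> T \<and> T \<subseteq> S"
        using xn openin_near[OF J(1,2) xX, of \<epsilon>] V(2) U(2) by (intro exI[of _ "near J \<epsilon> x"]) auto
    qed
  qed
  then show ?thesis using H by (simp add: uniformizable_by_def topology_eq)
qed

lemma star_iter_near_cover_relatively_compact:
  assumes i: "i \<in> I" and ulc: "uniformly_locally_compact_metric (M i)"
  obtains \<epsilon> where "\<epsilon> > 0" "\<And>m U. U \<in> near_cover {i} \<epsilon> \<Longrightarrow>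
    \<exists>K. compactin (mtopology_of (M i)) K \<and> (\<forall>y\<in>star_iter m U (near_cover {i} \<epsilon>). e y i \<in> K)"
proof -
  obtain \<epsilon> where e: "\<epsilon> > 0" and K: "\<And>K. compactin (mtopology_of (M i)) K \<Longrightarrow>
       \<exists>K'. compactin (mtopology_of (M i)) K' \<and> (\<forall>x\<in>K. \<forall>y\<in>mspace (M i). mdist (M i) x y < \<epsilon> \<longrightarrow> y \<in> K')"
    using ulc unfolding uniformly_locally_compact_metric_def by blast
  let ?N = "near_cover {i} (\<epsilon>/2)"
  have close: "mdist (M i) (e x i) (e y i) < \<epsilon>" "e y i \<in> mspace (M i)"
    if xy: "V \<in> ?N" "x \<in> V" "y \<in> V" for V x y
  proof -
    obtain z where z: "z \<in> topspace X" "V = near {i} (\<epsilon>/2) z" using xy(1) by (auto simp: near_cover_def)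
    then have m: "e z i \<in> mspace (M i)" "e x i \<in> mspace (M i)" "e y i \<in> mspace (M i)"
      using xy mem[OF _ i] by (auto simp: near_def)
    then show "e y i \<in> mspace (M i)" by simp
    have "mdist (M i) (e x i) (e y i) \<le> mdist (M i) (e x i) (e z i) + mdist (M i) (e z i) (e y i)"
      using m by (intro mdist_triangle) auto
    moreover have "mdist (M i) (e z i) (e x i) < \<epsilon>/2" "mdist (M i) (e z i) (e y i) < \<epsilon>/2"
      using xy z by (auto simp: near_def)
    ultimately show "mdist (M i) (e x i) (e y i) < \<epsilon>"
      using mdist_commute[of "M i" "e x i" "e z i"] by linarith
  qed
  show ?thesis
  proof
    show "\<epsilon>/2 > 0" using e by simp
    fix m U assume U: "U \<in> ?N"
    show "\<exists>K. compactin (mtopology_of (M i)) K \<and> (\<forall>y\<in>star_iter m U ?N. e y i \<in> K)"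
    proof (induction m)
      case 0
      obtain z where z: "z \<in> topspace X" "U = near {i} (\<epsilon>/2) z" using U by (auto simp: near_cover_def)
      have "compactin (mtopology_of (M i)) {e z i}" using mem[OF z(1) i] by simp
      then obtain K' where K': "compactin (mtopology_of (M i)) K'"
        "\<forall>y\<in>mspace (M i). mdist (M i) (e z i) y < \<epsilon> \<longrightarrow> y \<in> K'"
        using K by blast
      have "e y i \<in> K'" if "y \<in> U" for y
        using K'(2) close[OF U _ that, of z] near_refl[OF z(1), of "{i}" "\<epsilon>/2"] i e z(2) by auto
      then show ?case using K'(1) by auto
    next
      case (Suc m)
      then obtain K0 where K0: "compactin (mtopology_of (M i)) K0" "\<forall>y\<in>star_iter m U ?N. e y i \<in> K0"
        by blast
      then obtain K' where K': "compactin (mtopology_of (M i)) K'"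
        "\<forall>x\<in>K0. \<forall>y\<in>mspace (M i). mdist (M i) x y < \<epsilon> \<longrightarrow> y \<in> K'"
        using K by blast
      have "e y i \<in> K'" if y: "y \<in> star_iter (Suc m) U ?N" for y
      proof -
        obtain V x where "V \<in> ?N" "y \<in> V" "x \<in> V" "x \<in> star_iter m U ?N"
          using y by (auto simp: star_def)
        then show ?thesis using close[of V x y] K0(2) K'(2) by blast
      qed
      then show ?case using K'(1) by blast
    qed
  qed
qed

text \<open>Only finitely many coordinates can be controlled at once by a member of the filter, so Bourbaki-Cauchy
  filters are first refined to ultrafilters, which converge in each coordinate.\<close>

lemma bourbaki_complete_coordinate_uniformity:
  assumes ulc: "\<And>i. i \<in> I \<Longrightarrow> uniformly_locally_compact_metric (M i)"
  shows "bourbaki_complete (topspace X) coordinate_uniformity"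
  unfolding bourbaki_complete_def
proof (intro allI impI)
  fix F assume F: "bourbaki_cauchy_filter (topspace X) coordinate_uniformity F"
  have top: "uniform_topology (topspace X) coordinate_uniformity = X"
    using uniformizable_by_coordinate_uniformity by (simp add: uniformizable_by_def)
  have F0: "F \<noteq> bot" and FX: "F \<le> principal (topspace X)"
    using F unfolding bourbaki_cauchy_filter_def filter_on_def by auto
  obtain G where G: "G \<noteq> bot" "G \<le> F" "\<And>P. eventually P G \<or> eventually (\<lambda>x. \<not> P x) G"
    using ultrafilter_below[OF F0] by metis
  have "\<exists>l. limitin (mtopology_of (M i)) (\<lambda>x. e x i) l G" if i: "i \<in> I" for i
  proof -
    obtain \<epsilon> where e: "\<epsilon> > 0" "\<And>m U. U \<in> near_cover {i} \<epsilon> \<Longrightarrow>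
      \<exists>K. compactin (mtopology_of (M i)) K \<and> (\<forall>y\<in>star_iter m U (near_cover {i} \<epsilon>). e y i \<in> K)"
      using star_iter_near_cover_relatively_compact[OF i ulc[OF i]] by metis
    have "near_cover {i} \<epsilon> \<in> coordinate_uniformity" using i e(1) by (intro near_cover_uniform) auto
    then obtain m U where U: "U \<in> near_cover {i} \<epsilon>" "eventually (\<lambda>x. x \<in> star_iter m U (near_cover {i} \<epsilon>)) F"
      using F unfolding bourbaki_cauchy_filter_def by meson
    obtain K where K: "compactin (mtopology_of (M i)) K" "\<forall>y\<in>star_iter m U (near_cover {i} \<epsilon>). e y i \<in> K"
      using e(2)[OF U(1)] by blast
    have "eventually (\<lambda>x. e x i \<in> K) F" using U(2) by (rule eventually_mono) (use K(2) in blast)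
    then have "eventually (\<lambda>x. e x i \<in> K) G" using G(2) by (rule filter_leD[rotated])
    then show ?thesis using ultrafilter_limit_in_compact[OF K(1) _ G(1,3)] by metis
  qed
  then obtain x where x: "limitin X id x G"
    using conv[of G] G(1,2) FX unfolding filter_on_def by (meson order_trans)
  have "cluster_point_of X F x"
    unfolding cluster_point_of_def in_closure_of
  proof (intro allI impI conjI)
    show "x \<in> topspace X" using limitin_topspace[OF x] .
    fix S T assume S: "eventually (\<lambda>y. y \<in> S) F" and T: "x \<in> T \<and> openin X T"
    have "eventually (\<lambda>y. y \<in> S) G" by (rule filter_leD[OF G(2) S])
    moreover have "eventually (\<lambda>y. y \<in> T) G" using limitinD[OF x, of T] T by simp
    ultimately have "eventually (\<lambda>y. y \<in> S \<and> y \<in> T) G" by (rule eventually_conj)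
    then show "\<exists>y. y \<in> S \<and> y \<in> T" using eventually_happens'[OF G(1)] by blast
  qed
  then show "\<exists>x. cluster_point_of (uniform_topology (topspace X) coordinate_uniformity) F x"
    unfolding top by blast
qed

end

lemma closed_in_locally_compact_product_imp_bourbaki_complete:
  fixes M :: "'i \<Rightarrow> 'm metric"
  assumes lc: "\<And>i. i \<in> I \<Longrightarrow> locally_compact_space (mtopology_of (M i))"
    and cl: "closed_subspace_of X (product_topology (\<lambda>i. mtopology_of (M i)) I)"
  obtains \<mu> where "uniformizable_by X \<mu>" "bourbaki_complete (topspace X) \<mu>"
proof -
  have "\<forall>i\<in>I. \<exists>m. mtopology_of m = mtopology_of (M i) \<and> uniformly_locally_compact_metric m"
    using locally_compact_imp_uniformly_locally_compact_metric[OF lc] by metis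
  then obtain N where N: "\<And>i. i \<in> I \<Longrightarrow> mtopology_of (N i) = mtopology_of (M i)"
      "\<And>i. i \<in> I \<Longrightarrow> uniformly_locally_compact_metric (N i)"
    by metis
  obtain e where e: "continuous_map X (product_topology (\<lambda>i. mtopology_of (M i)) I) e"
    "inj_on e (topspace X)"
    "\<And>F y. filter_on (topspace X) F \<Longrightarrow> limitin (product_topology (\<lambda>i. mtopology_of (M i)) I) e y F
      \<Longrightarrow> \<exists>x. limitin X id x F"
    using closed_subspace_ofE[OF cl] by metis
  have comp: "e ` topspace X \<subseteq> extensional I"
    "\<And>i. i \<in> I \<Longrightarrow> continuous_map X (mtopology_of (M i)) (\<lambda>x. e x i)"
    using e(1) unfolding continuous_map_componentwise by auto
  interpret metric_coordinates X I N e
  proof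
    show "continuous_map X (mtopology_of (N i)) (\<lambda>x. e x i)" if "i \<in> I" for i
      using comp(2)[OF that] N(1)[OF that] by simp
    show "x = y" if xy: "x \<in> topspace X" "y \<in> topspace X" "\<And>i. i \<in> I \<Longrightarrow> e x i = e y i" for x y
    proof -
      have "e x = e y" using comp(1) xy by (intro extensionalityI[of _ I]) auto
      then show ?thesis using e(2) xy by (simp add: inj_on_def)
    qed
    fix F :: "'a filter" assume F: "filter_on (topspace X) F"
      and lim: "\<And>i. i \<in> I \<Longrightarrow> \<exists>l. limitin (mtopology_of (N i)) (\<lambda>x. e x i) l F"
    obtain l where l: "\<And>i. i \<in> I \<Longrightarrow> limitin (mtopology_of (M i)) (\<lambda>x. e x i) (l i) F"
      using lim N(1) by metis
    have "eventually (\<lambda>x. x \<in> topspace X) F" using F unfolding filter_on_def le_principal by simp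
    then have "eventually (\<lambda>x. e x \<in> topspace (product_topology (\<lambda>i. mtopology_of (M i)) I)) F"
      by (rule eventually_mono) (use continuous_map_image_subset_topspace[OF e(1)] in blast)
    then have "limitin (product_topology (\<lambda>i. mtopology_of (M i)) I) e (restrict l I) F"
      unfolding limitin_componentwise using l by simp
    then show "\<exists>x. limitin X id x F" using e(3)[OF F] by blast
  qed
  show ?thesis
    using that uniformizable_by_coordinate_uniformity bourbaki_complete_coordinate_uniformity[OF N(2)]
    by blast
qed

section \<open>Embeddings into products\<close>

lemma continuous_map_to_discrete:
  assumes "\<And>x. x \<in> topspace X \<Longrightarrow> f x \<in> D" "\<And>d. d \<in> D \<Longrightarrow> openin X {x \<in> topspace X. f x = d}"
  shows "continuous_map X (discrete_topology D) f"
  unfolding continuous_map_def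
proof (intro conjI allI impI)
  show "f \<in> topspace X \<rightarrow> topspace (discrete_topology D)" using assms(1) by auto
  fix U assume "openin (discrete_topology D) U"
  then have "{x \<in> topspace X. f x \<in> U} = (\<Union>d\<in>U. {x \<in> topspace X. f x = d})" "U \<subseteq> D" by auto
  then show "openin X {x \<in> topspace X. f x \<in> U}" using assms(2) by (auto intro!: openin_Union)
qed

lemma open_partition_fibres:
  assumes f: "continuous_map X (discrete_topology D) f"
  shows "open_partition X ((\<lambda>d. {x \<in> topspace X. f x = d}) ` D - {{}})"
proof -
  have "f x \<in> D" if "x \<in> topspace X" for x
    using continuous_map_image_subset_topspace[OF f] that by auto
  moreover have "openin X {x \<in> topspace X. f x = d}" if "d \<in> D" for d
    using openin_continuous_map_preimage[OF f, of "{d}"] that by simp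
  ultimately show ?thesis
    unfolding open_partition_def partition_on_def disjoint_def by auto
qed

text \<open>Labelling the members of an open partition by points of \<open>D\<close> is a continuous map to the discrete space \<open>D\<close>.\<close>

lemma open_partition_indexing:
  assumes P: "open_partition X \<P>" and \<iota>: "\<iota> ` \<P> \<subseteq> D"
  obtains f where "continuous_map X (discrete_topology D) f" "\<And>p x. p \<in> \<P> \<Longrightarrow> x \<in> p \<Longrightarrow> f x = \<iota> p"
proof -
  have un: "\<Union>\<P> = topspace X" and dis: "\<And>p q. p \<in> \<P> \<Longrightarrow> q \<in> \<P> \<Longrightarrow> p \<noteq> q \<Longrightarrow> p \<inter> q = {}"
    and op: "\<And>p. p \<in> \<P> \<Longrightarrow> openin X p"
    using P by (auto simp: open_partition_def partition_on_def disjoint_def)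
  define f where "f x = \<iota> (THE p. p \<in> \<P> \<and> x \<in> p)" for x
  have f: "f x = \<iota> p" if "p \<in> \<P>" "x \<in> p" for p x
  proof -
    have "(THE p. p \<in> \<P> \<and> x \<in> p) = p" using that dis by (intro the_equality) auto
    then show ?thesis by (simp add: f_def)
  qed
  have "continuous_map X (discrete_topology D) f"
  proof (rule continuous_map_to_discrete)
    show "f x \<in> D" if "x \<in> topspace X" for x
    proof -
      obtain p where "p \<in> \<P>" "x \<in> p" using un \<open>x \<in> topspace X\<close> by (metis UnionE)
      then show ?thesis using f \<iota> by auto
    qed
    fix d assume "d \<in> D"
    have "{x \<in> topspace X. f x = d} = \<Union>{p \<in> \<P>. \<iota> p = d}"
    proof
      show "{x \<in> topspace X. f x = d} \<subseteq> \<Union>{p \<in> \<P>. \<iota> p = d}"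
      proof
        fix x assume x: "x \<in> {x \<in> topspace X. f x = d}"
        then obtain p where "p \<in> \<P>" "x \<in> p" using un by (metis CollectD UnionE)
        then show "x \<in> \<Union>{p \<in> \<P>. \<iota> p = d}" using f x by auto
      qed
      show "\<Union>{p \<in> \<P>. \<iota> p = d} \<subseteq> {x \<in> topspace X. f x = d}" using f un by auto
    qed
    then show "openin X {x \<in> topspace X. f x = d}" using op by auto
  qed
  then show ?thesis using that f by blast
qed

lemma card_Field_cellularity: "|Field (cellularity X)| =o cellularity X"
  using cellularity_bound_cellularity[of X] card_of_Field_ordIso unfolding cellularity_bound_def by blast

lemma open_partition_inj_cellularity:
  assumes "open_partition X \<P>"
  obtains \<iota> where "inj_on \<iota> \<P>" "\<iota> ` \<P> \<subseteq> Field (cellularity X)"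
proof -
  have "|\<P>| \<le>o cellularity X"
    using cellularity_bound_cellularity[of X] assms unfolding cellularity_bound_def by simp
  then have "|\<P>| \<le>o |Field (cellularity X)|"
    using ordLeq_ordIso_trans ordIso_symmetric[OF card_Field_cellularity] by blast
  then show ?thesis using that card_of_ordLeq[of \<P> "Field (cellularity X)"] by auto
qed

lemma Field_cellularity_nonempty:
  assumes "topspace X \<noteq> {}"
  shows "Field (cellularity X) \<noteq> {}"
proof -
  have "open_partition X {topspace X}"
    using assms by (auto simp: open_partition_def partition_on_def simp del: null_topspace_iff_trivial)
  then obtain \<iota> :: "'a set \<Rightarrow> 'a" where "\<iota> ` {topspace X} \<subseteq> Field (cellularity X)"
    using open_partition_inj_cellularity by metis
  then show ?thesis by auto
qed

text \<open>In \<open>function_complete\<close>, partitions may be replaced by maps into the one discrete space whose points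
  are the field of the cellularity, since every open partition can be labelled injectively there.\<close>

lemma function_complete_limit:
  assumes X: "function_complete X" and F: "filter_on (topspace X) F"
    and disc: "\<And>f. continuous_map X (discrete_topology (Field (cellularity X))) f
       \<Longrightarrow> \<exists>d. eventually (\<lambda>x. f x = d) F"
    and real: "\<And>g. continuous_map X euclideanreal g \<Longrightarrow> \<exists>l. (g \<longlongrightarrow> l) F"
  shows "\<exists>x. limitin X id x F"
proof -
  have F0: "F \<noteq> bot" and FX: "eventually (\<lambda>x. x \<in> topspace X) F"
    using F unfolding filter_on_def le_principal by auto
  have "\<exists>p\<in>\<P>. eventually (\<lambda>x. x \<in> p) F" if P: "open_partition X \<P>" for \<P>
  proof -
    have un: "\<Union>\<P> = topspace X" using P by (simp add: open_partition_def partition_on_def)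
    obtain \<iota> where \<iota>: "inj_on \<iota> \<P>" "\<iota> ` \<P> \<subseteq> Field (cellularity X)"
      using open_partition_inj_cellularity[OF P] by metis
    obtain f where f: "continuous_map X (discrete_topology (Field (cellularity X))) f"
      "\<And>p x. p \<in> \<P> \<Longrightarrow> x \<in> p \<Longrightarrow> f x = \<iota> p"
      using open_partition_indexing[OF P \<iota>(2)] by metis
    obtain d where d: "eventually (\<lambda>x. f x = d) F" using disc[OF f(1)] by blast
    obtain x where "f x = d" "x \<in> topspace X"
      using eventually_happens'[OF F0 eventually_conj[OF d FX]] by auto
    then obtain p where p: "p \<in> \<P>" "\<iota> p = d" using un f(2) by (metis UnionE)
    have "eventually (\<lambda>x. x \<in> p) F"
      using d FX
    proof eventually_elim
      case (elim x)
      then obtain q where q: "q \<in> \<P>" "x \<in> q" using un by (metis UnionE)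
      then have "\<iota> q = \<iota> p" using f(2) elim(1) p(2) by simp
      then show ?case using q inj_onD[OF \<iota>(1)] p(1) by auto
    qed
    then show ?thesis using p(1) by blast
  qed
  then show ?thesis using X F real unfolding function_complete_def by simp
qed

lemma tychonoff_real_functions_separate:
  assumes "tychonoff_space X" "x \<in> topspace X" "y \<in> topspace X" "x \<noteq> y"
  obtains g where "continuous_map X euclideanreal g" "g x \<noteq> g y"
proof -
  obtain S where "openin X S" "x \<in> S" "y \<notin> S"
    using assms unfolding tychonoff_space_def Hausdorff_space_def by (metis disjnt_iff)
  then obtain g where g: "continuous_map X euclideanreal g" "g x = 0" "{y \<in> topspace X. g y < 2/3} \<subseteq> S"
    using tychonoff_threshold_cover[OF assms(1)] by metis
  then have "g y \<noteq> 0" using assms(3) \<open>y \<notin> S\<close> by force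
  then show ?thesis using that g by metis
qed

text \<open>The index set consists of functions into the sum type \<open>\<open>'a + real\<close>\<close>. Each index \<open>\<phi>\<close> serves both factors: \<open>p \<phi>\<close> reads
  off the values in the left summand and \<open>q \<phi>\<close> those in the right summand, with the defaults \<open>d0\<close> and \<open>0\<close>. All maps to
  \<open>D\<close> and all real functions arise in this way.\<close>

lemma function_complete_imp_closed_in_discrete_real_power:
  fixes X :: "'a topology"
  assumes X: "tychonoff_space X" and fc: "function_complete X"
  shows "closed_in_discrete_real_power TYPE('a) TYPE('a \<Rightarrow> 'a + real) X"
proof -
  define D where "D = Field (cellularity X)"
  define d0 where "d0 = (SOME d. d \<in> D)"
  define p where "p \<phi> x = (case \<phi> x of Inl d \<Rightarrow> d | Inr _ \<Rightarrow> d0)" for \<phi> :: "'a \<Rightarrow> 'a + real" and x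
  define q where "q \<phi> x = (case \<phi> x of Inl _ \<Rightarrow> 0 | Inr r \<Rightarrow> r)" for \<phi> :: "'a \<Rightarrow> 'a + real" and x
  define I where "I = {\<phi>. continuous_map X (discrete_topology D) (p \<phi>) \<and> continuous_map X euclideanreal (q \<phi>)}"
  define E where "E x = ((\<lambda>\<phi>\<in>I. p \<phi> x), (\<lambda>\<phi>\<in>I. q \<phi> x))" for x
  let ?Y = "prod_topology (product_topology (\<lambda>_. discrete_topology D) I) (product_topology (\<lambda>_. euclideanreal) I)"
  have d0: "d0 \<in> D" if "topspace X \<noteq> {}"
    using Field_cellularity_nonempty[OF that] unfolding d0_def D_def by (simp add: some_in_eq)
  have Inl_mem: "Inl \<circ> f \<in> I" if "continuous_map X (discrete_topology D) f" for f
  proof -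
    have "p (Inl \<circ> f) = f" "q (Inl \<circ> f) = (\<lambda>_. 0)" by (auto simp: p_def q_def)
    then show ?thesis using that by (simp add: I_def)
  qed
  have Inr_mem: "Inr \<circ> g \<in> I" if "continuous_map X euclideanreal g" "topspace X \<noteq> {}" for g
  proof -
    have "p (Inr \<circ> g) = (\<lambda>_. d0)" "q (Inr \<circ> g) = g" by (auto simp: p_def q_def)
    then show ?thesis using that d0 by (simp add: I_def)
  qed
  have "closed_subspace_of X ?Y"
  proof (rule closed_subspace_ofI)
    show "Hausdorff_space ?Y"
      by (simp add: Hausdorff_space_prod_topology Hausdorff_space_product_topology)
    show "continuous_map X ?Y E"
      unfolding continuous_map_pairwise continuous_map_componentwise
      by (auto simp: E_def o_def I_def)
    show "inj_on E (topspace X)"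
    proof (rule inj_onI, rule ccontr)
      fix x y assume xy: "x \<in> topspace X" "y \<in> topspace X" "E x = E y" "x \<noteq> y"
      obtain g where g: "continuous_map X euclideanreal g" "g x \<noteq> g y"
        using tychonoff_real_functions_separate[OF X xy(1,2,4)] by metis
      have m: "Inr \<circ> g \<in> I" using Inr_mem[OF g(1)] xy(1) by blast
      have "snd (E x) (Inr \<circ> g) = snd (E y) (Inr \<circ> g)" using xy(3) by simp
      then show False using g(2) m by (simp add: E_def q_def)
    qed
    fix F y assume F: "filter_on (topspace X) F" and lim: "limitin ?Y E y F"
    have F0: "F \<noteq> bot" and FX: "eventually (\<lambda>x. x \<in> topspace X) F"
      using F unfolding filter_on_def le_principal by auto
    have ne: "topspace X \<noteq> {}" using eventually_happens'[OF F0 FX] by blast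
    have l1: "limitin (discrete_topology D) (\<lambda>x. fst (E x) \<phi>) (fst y \<phi>) F"
      and l2: "limitin euclideanreal (\<lambda>x. snd (E x) \<phi>) (snd y \<phi>) F" if "\<phi> \<in> I" for \<phi>
      using lim that unfolding limitin_pairwise limitin_componentwise by auto
    show "\<exists>x. limitin X id x F"
    proof (rule function_complete_limit[OF fc F])
      fix f assume f: "continuous_map X (discrete_topology (Field (cellularity X))) f"
      then have m: "Inl \<circ> f \<in> I" using Inl_mem by (simp add: D_def)
      let ?d = "fst y (Inl \<circ> f)"
      have "openin (discrete_topology D) {?d}" using limitin_topspace[OF l1[OF m]] by simp
      then have "eventually (\<lambda>x. fst (E x) (Inl \<circ> f) \<in> {?d}) F" using limitinD[OF l1[OF m]] by blast
      then show "\<exists>d. eventually (\<lambda>x. f x = d) F" using m by (auto simp: E_def p_def)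
    next
      fix g assume g: "continuous_map X euclideanreal g"
      have m: "Inr \<circ> g \<in> I" using Inr_mem[OF g ne] .
      have "(\<lambda>x. snd (E x) (Inr \<circ> g)) = g" using m by (auto simp: E_def q_def)
      then show "\<exists>l. (g \<longlongrightarrow> l) F" using l2[OF m] by auto
    qed
  qed
  then show ?thesis
    unfolding closed_in_discrete_real_power_def using card_Field_cellularity[of X] D_def by blast
qed

text \<open>The real line as a metric space on the right summand of \<open>'a + real\<close>.\<close>

definition real_copy :: "('a + real) metric" where
  "real_copy = metric (range Inr, \<lambda>x y. dist (projr x) (projr y))"

lemma real_copy:
  "mspace (real_copy :: ('a + real) metric) = range Inr"
  "mdist (real_copy :: ('a + real) metric) = (\<lambda>x y. dist (projr x) (projr y))"
proof -
  interpret Metric_space "range Inr" "\<lambda>x y :: 'a + real. dist (projr x) (projr y)"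
    by unfold_locales (auto simp: dist_commute dist_triangle)
  show "mspace (real_copy :: ('a + real) metric) = range Inr"
    "mdist (real_copy :: ('a + real) metric) = (\<lambda>x y. dist (projr x) (projr y))"
    unfolding real_copy_def by (simp_all only: mspace_metric mdist_metric)
qed

lemma continuous_map_Inr_real_copy:
  "continuous_map euclideanreal (mtopology_of (real_copy :: ('a + real) metric)) Inr"
proof -
  have "Lipschitz_continuous_map euclidean_metric (real_copy :: ('a + real) metric) Inr"
    by (auto simp: Lipschitz_continuous_map_def real_copy intro!: exI[of _ 1])
  then show ?thesis using Lipschitz_continuous_imp_continuous_map by fastforce
qed

lemma continuous_map_projr_real_copy:
  "continuous_map (mtopology_of (real_copy :: ('a + real) metric)) euclideanreal projr"
proof -
  have "Lipschitz_continuous_map (real_copy :: ('a + real) metric) euclidean_metric projr"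
    by (auto simp: Lipschitz_continuous_map_def real_copy intro!: exI[of _ 1])
  then show ?thesis using Lipschitz_continuous_imp_continuous_map by fastforce
qed

lemma locally_compact_real_copy: "locally_compact_space (mtopology_of (real_copy :: ('a + real) metric))"
proof -
  have "homeomorphic_maps euclideanreal (mtopology_of (real_copy :: ('a + real) metric)) Inr projr"
    unfolding homeomorphic_maps_def
    using continuous_map_Inr_real_copy continuous_map_projr_real_copy by (auto simp: real_copy)
  then have "euclideanreal homeomorphic_space mtopology_of (real_copy :: ('a + real) metric)"
    unfolding homeomorphic_space_def by blast
  then show ?thesis using homeomorphic_locally_compact_space locally_compact_space_euclidean by blast
qed

text \<open>The discrete metric space on the left summand of \<open>'a + real\<close>.\<close>

definition discrete_copy :: "('a + real) metric" where
  "discrete_copy = metric (range Inl, discrete_metric.dd)"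

lemma mtopology_of_discrete_copy: "mtopology_of discrete_copy = discrete_topology (range Inl)"
proof -
  interpret discrete_metric "range Inl" .
  show ?thesis unfolding discrete_copy_def by (simp add: mtopology_discrete_metric)
qed

text \<open>Again the continuous maps themselves are the indices: a map into the left summand is taken as a map to
  the discrete space, any other one as a map to the copy of the real line.\<close>

lemma function_complete_imp_closed_in_locally_compact_metric_product:
  fixes X :: "'a topology"
  assumes X: "tychonoff_space X" and fc: "function_complete X"
  shows "closed_in_locally_compact_metric_product TYPE('a \<Rightarrow> 'a + real) TYPE('a + real) X"
proof -
  define M :: "('a \<Rightarrow> 'a + real) \<Rightarrow> ('a + real) metric"
    where "M \<phi> = (if \<phi> ` topspace X \<subseteq> range Inl then discrete_copy else real_copy)" for \<phi>
  define I where "I = {\<phi>. continuous_map X (mtopology_of (M \<phi>)) \<phi>}"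
  define E where "E x = (\<lambda>\<phi>\<in>I. \<phi> x)" for x
  let ?Y = "product_topology (\<lambda>\<phi>. mtopology_of (M \<phi>)) I"
  have MInl: "M (Inl \<circ> f) = discrete_copy" for f by (auto simp: M_def)
  have MInr: "M (Inr \<circ> g) = real_copy" if ne: "topspace X \<noteq> {}" for g
  proof -
    obtain x where "x \<in> topspace X" using ne by blast
    then have "\<not> (Inr \<circ> g :: 'a \<Rightarrow> 'a + real) ` topspace X \<subseteq> range Inl" by (auto simp: image_subset_iff)
    then show ?thesis unfolding M_def by (rule if_not_P)
  qed
  have Inl_mem: "Inl \<circ> f \<in> I" if f: "continuous_map X (discrete_topology (Field (cellularity X))) f" for f
  proof -
    have "continuous_map (discrete_topology (Field (cellularity X)))
        (discrete_topology (range Inl)) (Inl :: 'a \<Rightarrow> 'a + real)"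
      by auto
    with f have "continuous_map X (discrete_topology (range Inl)) (Inl \<circ> f :: 'a \<Rightarrow> 'a + real)"
      by (rule continuous_map_compose)
    then show ?thesis by (simp add: I_def MInl mtopology_of_discrete_copy)
  qed
  have Inr_mem: "Inr \<circ> g \<in> I" if "continuous_map X euclideanreal g" "topspace X \<noteq> {}" for g
    using continuous_map_compose[OF that(1) continuous_map_Inr_real_copy] MInr[OF that(2)] by (simp add: I_def)
  have lc: "locally_compact_space (mtopology_of (M \<phi>))" for \<phi>
    by (simp add: M_def locally_compact_real_copy mtopology_of_discrete_copy locally_compact_space_discrete_topology)
  have "closed_subspace_of X ?Y"
  proof (rule closed_subspace_ofI)
    show "Hausdorff_space ?Y"
      unfolding Hausdorff_space_product_topology mtopology_of_def
      by (simp add: Metric_space.Hausdorff_space_mtopology)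
    show "continuous_map X ?Y E"
      unfolding continuous_map_componentwise by (auto simp: E_def I_def)
    show "inj_on E (topspace X)"
    proof (rule inj_onI, rule ccontr)
      fix x y assume xy: "x \<in> topspace X" "y \<in> topspace X" "E x = E y" "x \<noteq> y"
      obtain g where g: "continuous_map X euclideanreal g" "g x \<noteq> g y"
        using tychonoff_real_functions_separate[OF X xy(1,2,4)] by metis
      have m: "Inr \<circ> g \<in> I" using Inr_mem[OF g(1)] xy(1) by blast
      have "E x (Inr \<circ> g) = E y (Inr \<circ> g)" using xy(3) by simp
      then show False using g(2) m by (simp add: E_def)
    qed
    fix F y assume F: "filter_on (topspace X) F" and lim: "limitin ?Y E y F"
    have F0: "F \<noteq> bot" and FX: "eventually (\<lambda>x. x \<in> topspace X) F"
      using F unfolding filter_on_def le_principal by auto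
    have ne: "topspace X \<noteq> {}" using eventually_happens'[OF F0 FX] by blast
    have l: "limitin (mtopology_of (M \<phi>)) \<phi> (y \<phi>) F" if "\<phi> \<in> I" for \<phi>
    proof -
      have "limitin (mtopology_of (M \<phi>)) (\<lambda>x. E x \<phi>) (y \<phi>) F"
        using lim that unfolding limitin_componentwise by blast
      moreover have "(\<lambda>x. E x \<phi>) = \<phi>" using that by (auto simp: E_def)
      ultimately show ?thesis by simp
    qed
    show "\<exists>x. limitin X id x F"
    proof (rule function_complete_limit[OF fc F])
      fix f assume f: "continuous_map X (discrete_topology (Field (cellularity X))) f"
      let ?d = "y (Inl \<circ> f)"
      have lf: "limitin (discrete_topology (range Inl)) (Inl \<circ> f) ?d F"
        using l[OF Inl_mem[OF f]] by (simp only: MInl mtopology_of_discrete_copy)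
      have "?d \<in> range Inl" using limitin_topspace[OF lf] by simp
      then obtain d where d: "?d = Inl d" by blast
      have "openin (discrete_topology (range Inl)) {?d}" using d by simp
      then have "eventually (\<lambda>x. (Inl \<circ> f) x \<in> {?d}) F" using limitinD[OF lf] by blast
      then have "eventually (\<lambda>x. f x = d) F" by (simp add: d)
      then show "\<exists>d. eventually (\<lambda>x. f x = d) F" by blast
    next
      fix g assume g: "continuous_map X euclideanreal g"
      have "limitin (mtopology_of real_copy) (Inr \<circ> g :: 'a \<Rightarrow> 'a + real) (y (Inr \<circ> g)) F"
        using l[OF Inr_mem[OF g ne]] MInr[OF ne] by simp
      then have "limitin euclideanreal (projr \<circ> (Inr \<circ> g :: 'a \<Rightarrow> 'a + real)) (projr (y (Inr \<circ> g))) F"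
        by (rule continuous_map_limit[OF continuous_map_projr_real_copy])
      then show "\<exists>l. (g \<longlongrightarrow> l) F" by (auto simp: o_def)
    qed
  qed
  then show ?thesis unfolding closed_in_locally_compact_metric_product_def using lc by blast
qed

lemma closed_in_discrete_real_power_imp_function_complete:
  assumes "closed_in_discrete_real_power TYPE('d) TYPE('i) X"
  shows "function_complete X"
proof -
  obtain D :: "'d set" and I :: "'i set" where cl: "closed_subspace_of X
      (prod_topology (product_topology (\<lambda>_. discrete_topology D) I) (product_topology (\<lambda>_. euclideanreal) I))"
    (is "closed_subspace_of X ?Y")
    using assms unfolding closed_in_discrete_real_power_def by blast
  obtain e where e: "continuous_map X ?Y e"
    "\<And>F y. filter_on (topspace X) F \<Longrightarrow> limitin ?Y e y F \<Longrightarrow> \<exists>x. limitin X id x F"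
    using closed_subspace_ofE[OF cl] by metis
  have c1: "continuous_map X (discrete_topology D) (\<lambda>x. fst (e x) i)"
    and c2: "continuous_map X euclideanreal (\<lambda>x. snd (e x) i)" if "i \<in> I" for i
    using e(1) that unfolding continuous_map_pairwise continuous_map_componentwise by auto
  show ?thesis
    unfolding function_complete_def
  proof (intro allI impI)
    fix F assume F: "filter_on (topspace X) F"
      and part: "\<forall>\<P>. open_partition X \<P> \<longrightarrow> (\<exists>P\<in>\<P>. eventually (\<lambda>x. x \<in> P) F)"
      and real: "\<forall>g. continuous_map X euclideanreal g \<longrightarrow> (\<exists>l. (g \<longlongrightarrow> l) F)"
    have "\<exists>d. limitin (discrete_topology D) (\<lambda>x. fst (e x) i) d F" if i: "i \<in> I" for i
    proof -
      obtain d where d: "d \<in> D" "eventually (\<lambda>x. x \<in> {x \<in> topspace X. fst (e x) i = d}) F"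
        using part open_partition_fibres[OF c1[OF i]] by blast
      then have "eventually (\<lambda>x. fst (e x) i = d) F" by (auto elim: eventually_mono)
      then show ?thesis using d(1) by (intro exI[of _ d] limitin_eventually) simp_all
    qed
    then obtain a where a: "\<And>i. i \<in> I \<Longrightarrow> limitin (discrete_topology D) (\<lambda>x. fst (e x) i) (a i) F"
      by metis
    have "\<exists>l. limitin euclideanreal (\<lambda>x. snd (e x) i) l F" if i: "i \<in> I" for i
      using real c2[OF i] by simp
    then obtain b where b: "\<And>i. i \<in> I \<Longrightarrow> limitin euclideanreal (\<lambda>x. snd (e x) i) (b i) F"
      by metis
    have "eventually (\<lambda>x. x \<in> topspace X) F" using F unfolding filter_on_def le_principal by simp
    then have ev: "eventually (\<lambda>x. e x \<in> topspace ?Y) F"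
      by (rule eventually_mono) (use continuous_map_image_subset_topspace[OF e(1)] in blast)
    have "eventually (\<lambda>x. (fst \<circ> e) x \<in> topspace (product_topology (\<lambda>_. discrete_topology D) I)) F"
      "eventually (\<lambda>x. (snd \<circ> e) x \<in> topspace (product_topology (\<lambda>_. euclideanreal) I)) F"
      by (rule eventually_mono[OF ev]; auto)+
    then have "limitin ?Y e (restrict a I, restrict b I) F"
      unfolding limitin_pairwise limitin_componentwise using a b by simp
    then show "\<exists>x. limitin X id x F" using e(2)[OF F] by blast
  qed
qed

section \<open>Equivalence of the conditions\<close>

lemma closed_in_locally_compact_metric_product_imp_delta_complete:
  assumes X: "tychonoff_space X" and "closed_in_locally_compact_metric_product TYPE('j) TYPE('m) X"
  shows "delta_complete X"
proof -
  obtain I :: "'j set" and M :: "'j \<Rightarrow> 'm metric" where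
    "\<forall>i\<in>I. locally_compact_space (mtopology_of (M i))"
    "closed_subspace_of X (product_topology (\<lambda>i. mtopology_of (M i)) I)"
    using assms(2) unfolding closed_in_locally_compact_metric_product_def by blast
  then obtain \<mu> where "uniformizable_by X \<mu>" "bourbaki_complete (topspace X) \<mu>"
    using closed_in_locally_compact_product_imp_bourbaki_complete[of I M X] by metis
  then show ?thesis by (rule bourbaki_complete_imp_delta_complete[OF X])
qed

theorem theorem2p2p13:
  fixes X :: "'a topology"
  assumes "tychonoff_space X"
  shows
    "((\<exists>\<mu>. uniformizable_by X \<mu> \<and> bourbaki_complete (topspace X) \<mu>) \<longleftrightarrow> delta_complete X) \<and>
     (delta_complete X \<longleftrightarrow>
        closed_in_discrete_real_power TYPE('a) TYPE('a \<Rightarrow> 'a + real) X) \<and>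
     (delta_complete X \<longleftrightarrow>
        closed_in_locally_compact_metric_product TYPE('a \<Rightarrow> 'a + real) TYPE('a + real) X) \<and>
     (closed_in_discrete_real_power TYPE('d) TYPE('i) X \<longrightarrow> delta_complete X) \<and>
     (closed_in_locally_compact_metric_product TYPE('j) TYPE('m) X \<longrightarrow> delta_complete X)"
proof -
  have fc: "function_complete X" if "delta_complete X"
    using delta_complete_imp_function_complete[OF assms that] .
  have product: "closed_in_locally_compact_metric_product TYPE('a \<Rightarrow> 'a + real) TYPE('a + real) X"
    if "function_complete X"
    using function_complete_imp_closed_in_locally_compact_metric_product[OF assms that] .
  have delta: "delta_complete X" if "function_complete X"
    using closed_in_locally_compact_metric_product_imp_delta_complete[OF assms product[OF that]] .
  have "\<exists>\<mu>. uniformizable_by X \<mu> \<and> bourbaki_complete (topspace X) \<mu>" if d: "delta_complete X"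
  proof -
    obtain I :: "('a \<Rightarrow> 'a + real) set" and M :: "('a \<Rightarrow> 'a + real) \<Rightarrow> ('a + real) metric" where
      "\<forall>i\<in>I. locally_compact_space (mtopology_of (M i))"
      "closed_subspace_of X (product_topology (\<lambda>i. mtopology_of (M i)) I)"
      using product[OF fc[OF d]] unfolding closed_in_locally_compact_metric_product_def by blast
    then show ?thesis using closed_in_locally_compact_product_imp_bourbaki_complete[of I M X] by metis
  qed
  then have 1: "(\<exists>\<mu>. uniformizable_by X \<mu> \<and> bourbaki_complete (topspace X) \<mu>) \<longleftrightarrow> delta_complete X"
    using bourbaki_complete_imp_delta_complete[OF assms] by blast
  have 2: "closed_in_discrete_real_power TYPE('a) TYPE('a \<Rightarrow> 'a + real) X" if "delta_complete X"
    using function_complete_imp_closed_in_discrete_real_power[OF assms fc[OF that]] .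
  show ?thesis
  proof (intro conjI impI iffI)
    show "delta_complete X" if "closed_in_discrete_real_power TYPE('a) TYPE('a \<Rightarrow> 'a + real) X"
      using delta[OF closed_in_discrete_real_power_imp_function_complete[OF that]] .
    show "delta_complete X" if "closed_in_discrete_real_power TYPE('d) TYPE('i) X"
      using delta[OF closed_in_discrete_real_power_imp_function_complete[OF that]] .
  qed (use 1 2 product[OF fc] closed_in_locally_compact_metric_product_imp_delta_complete[OF assms] in simp_all)
qed

end
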